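(* Let $m\in\mathbb N$ and let $F_i$ be $U$-statistics of orders $k_i$ driven by nonnegative functions $f_i$, $i=1,\dots,m$, such that $\prod_{i=1}^mF_i\in L_2(P_\eta)$, and assume the hereditary density $p\in L_2(P_\eta)$. Then $$\mathbb E\prod_{i=1}^mF_i(\mu)=\sum_{\sigma\in\Pi_{k_1,\dots,k_m}}\int_{B^{|\sigma|}}\Big(\bigotimes_{i=1}^mf_i\Big)_\sigma(x_1,\dots,x_{|\sigma|})\;\mathbb E\,\lambda^*_{|\sigma|}(x_1,\dots,x_{|\sigma|},\mu)\;\lambda(d(x_1,\dots,x_{|\sigma|})).$$ In particular, for $m=2$ and $k_1\ge k_2$, $$\mathbb E[F_1(\mu)F_2(\mu)]=\sum_{j=0}^{k_2}\binom{k_2}{j}\frac{k_1!}{(k_1-k_2+j)!}\int_{B^{k_1+j}}h_{k_1,j}(x_1,\dots,x_{k_1+j})\,\mathbb E[\lambda^*_{k_1+j}(x_1,\dots,x_{k_1+j},\mu)]\,\lambda(d(x_1,\dots,x_{k_1+j})),$$ with $h_{k_1,j}(x_1,\dots,x_{k_1+j})=f_2(x_1,\dots,x_{k_2})f_1(x_1,\dots,x_{k_2-j},x_{k_2+1},\dots,x_{k_1+j})$.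
   Context: $B\subset\mathbb R^d$ is a bounded Borel set with $|B|>0$; $\mathbf N$ is the space of finite integer-valued measures (finite point configurations) on $B$. $\eta$ is a Poisson point process on $B$ with finite atomless intensity measure $\lambda$ and distribution $P_\eta$; $\lambda(d(x_1,\dots,x_n))$ denotes $\lambda^n$. $\mu$ is a point process with $dP_\mu=p\,dP_\eta$, $p\ge0$ measurable, $\int p\,dP_\eta=1$, hereditary ($p(x)>0\Rightarrow p(\tilde x)>0$ for $\tilde x\subset x$). Conditional intensities: $\lambda^*_n(u_1,\dots,u_n,x)=p(x\cup\{u_1,\dots,u_n\})/p(x)$ for $p(x)>0$ (distinct $u_i\notin x$), $=0$ if $p(x)=0$, $\lambda^*_0\equiv1$. A $U$-statistic of order $k$ driven by $f$: $F(x)=\sum_{(x_1,\dots,x_k)\in x^k_{\neq}}f(x_1,\dots,x_k)$, $f:B^k\to\mathbb R$ symmetric, $f\in L_1(\lambda^k)$, $x^k_{\neq}$ the $k$-tuples of pairwise distinct points of $x$. Partitions: for $k=k_1+\dots+k_m$, $\pi=\{J_1,\dots,J_m\}$ with $J_i=\{j:k_1+\dots+k_{i-1}<j\le k_1+\dots+k_i\}$; $\Pi_{k_1,\dots,k_m}$ is the set of partitions $\sigma$ of $\{1,\dots,k\}$ each of whose blocks meets each $J_i$ in at most one element; $|\sigma|$ is its number of blocks; $(\bigotimes_{i=1}^mf_i)_\sigma:B^{|\sigma|}\to\mathbb R$ is obtained from $(z_1,\dots,z_k)\mapsto\prod_i f_i(z_{k_1+\dots+k_{i-1}+1},\dots,z_{k_1+\dots+k_i})$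 by identifying the variables whose indices lie in the same block of $\sigma$. *)

theory Defs
  imports "HOL-Probability.Probability"
begin

(* Point configurations on B: finite subsets of B (lambda is atomless, so the Poisson
   process is a.s. simple).  Sigma-algebra generated by the counting maps x |-> card (x \<inter> A). *)
definition conf_space :: "'a::euclidean_space set \<Rightarrow> 'a set set" where
  "conf_space B = {x. finite x \<and> x \<subseteq> B}"

definition conf_sets :: "'a::euclidean_space set \<Rightarrow> 'a set set set" where
  "conf_sets B = sigma_sets (conf_space B)
      {{x \<in> conf_space B. card (x \<inter> A) = n} | A n. A \<in> sets borel}"

definition poisson_law :: "'a::euclidean_space measure \<Rightarrow> 'a set \<Rightarrow> 'a set measure" where
  "poisson_law lam B = measure_of (conf_space B) (conf_sets B)
     (\<lambda>S. ennreal (exp (- measure lam B)) *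
        (\<Sum>n. emeasure (PiM {..<n} (\<lambda>_. lam))
                 ((\<lambda>z. z ` {..<n}) -` S \<inter> space (PiM {..<n} (\<lambda>_. lam)))
               / ennreal (fact n)))"

definition ustat :: "nat \<Rightarrow> ((nat \<Rightarrow> 'a) \<Rightarrow> real) \<Rightarrow> 'a set \<Rightarrow> real" where
  "ustat k f x = (\<Sum>z \<in> {z. z \<in> PiE {..<k} (\<lambda>_. x) \<and> inj_on z {..<k}}. f z)"

definition lambda_star :: "('a set \<Rightarrow> real) \<Rightarrow> nat \<Rightarrow> (nat \<Rightarrow> 'a) \<Rightarrow> 'a set \<Rightarrow> real" where
  "lambda_star p n u x =
     (if n = 0 then 1 else if p x > 0 then p (x \<union> u ` {..<n}) / p x else 0)"

definition offs :: "(nat \<Rightarrow> nat) \<Rightarrow> nat \<Rightarrow> nat" where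
  "offs k i = (\<Sum>j<i. k j)"

definition Jblock :: "(nat \<Rightarrow> nat) \<Rightarrow> nat \<Rightarrow> nat set" where
  "Jblock k i = {offs k i ..< offs k i + k i}"

definition Pi_part :: "nat \<Rightarrow> (nat \<Rightarrow> nat) \<Rightarrow> nat set set set" where
  "Pi_part m k = {\<sigma>. partition_on {..<offs k m} \<sigma> \<and>
                      (\<forall>b\<in>\<sigma>. \<forall>i<m. card (b \<inter> Jblock k i) \<le> 1)}"

(* blocks of \<sigma> are enumerated 0..|\<sigma>|-1 in increasing order of their minima;
   bidx \<sigma> j is the number of the block containing j *)
definition bidx :: "nat set set \<Rightarrow> nat \<Rightarrow> nat" where
  "bidx \<sigma> j = card {b \<in> \<sigma>. Min b < Min (THE b. b \<in> \<sigma> \<and> j \<in> b)}"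

definition tensor_sigma :: "nat \<Rightarrow> (nat \<Rightarrow> nat) \<Rightarrow> (nat \<Rightarrow> (nat \<Rightarrow> 'a) \<Rightarrow> real)
                            \<Rightarrow> nat set set \<Rightarrow> (nat \<Rightarrow> 'a) \<Rightarrow> real" where
  "tensor_sigma m k f \<sigma> y =
     (\<Prod>i<m. f i (restrict (\<lambda>l. y (bidx \<sigma> (offs k i + l))) {..<k i}))"

definition h_fun :: "nat \<Rightarrow> nat \<Rightarrow> nat \<Rightarrow> ((nat \<Rightarrow> 'a) \<Rightarrow> real) \<Rightarrow> ((nat \<Rightarrow> 'a) \<Rightarrow> real)
                     \<Rightarrow> (nat \<Rightarrow> 'a) \<Rightarrow> real" where
  "h_fun k1 k2 j f1 f2 y =
     f2 (restrict y {..<k2}) *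
     f1 (restrict (\<lambda>l. if l < k2 - j then y l else y (l + j)) {..<k1})"

end

theory Submission
  imports Defs
begin

text \<open>
  Every product of $U$-statistics is pointwise a finite combination of single $U$-statistics: a tuple
  of injective index maps into a configuration is the same as its coincidence pattern, a partition
  \<open>\<sigma>\<close>, together with an injective map from the blocks of \<open>\<sigma>\<close>. For \<open>m = 2\<close> and symmetric kernels the
  sum can instead be grouped by the overlap of the two point sets, which produces the binomial
  coefficients. Each single $U$-statistic is integrated against \<open>p dP\<^sub>\<eta>\<close> by the multivariate
  Mecke formula, and heredity turns \<open>p (x \<union> y)\<close> into \<open>p x\<close> times the conditional intensity.

  The Mecke formula is not applied to configurations but to the series of integrals over
  \<open>\<lambda>\<^sup>n\<close> that defines the Poisson law. In this way only the whole product has to be measurable for the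
  \<open>\<sigma>\<close>-algebra of the counting maps, not each single $U$-statistic.
\<close>

section \<open>Injective tuples\<close>

text \<open>A configuration is a set, so the image of an n-tuple of points forgets repetitions.
  Atomlessness of \<open>lam\<close> makes the diagonals null, and off them the injective index maps
  into \<open>{..<n}\<close> correspond one to one to the injective tuples in the configuration.
  There are n! / (n - r)! such maps selecting r points, all with the same integral, so the Poisson
  weight 1 / n! becomes 1 / (n - r)!: shifting the series by r is the core of the Mecke formula. The
  identities live first in \<open>ennreal\<close>, where sums and integrals exchange freely. Square
  integrability of the product and of \<open>p\<close> enters at a single place, through 2ab \<le>
  a^2 + b^2, and makes the total finite. All terms being nonnegative, each one is then finite, and
  the identity descends to real integrals; without finiteness it could fail there, since a divergent
  Bochner integral is 0 by convention.\<close>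

definition injs :: "nat \<Rightarrow> 'a set \<Rightarrow> (nat \<Rightarrow> 'a) set" where
  "injs k x = {z. z \<in> PiE {..<k} (\<lambda>_. x) \<and> inj_on z {..<k}}"

lemma ustat_injs: "ustat k f x = (\<Sum>z\<in>injs k x. f z)"
  by (simp add: ustat_def injs_def)

lemma finite_injs: "finite x \<Longrightarrow> finite (injs k x)"
  unfolding injs_def by (rule finite_subset[of _ "PiE {..<k} (\<lambda>_. x)"]) (auto intro: finite_PiE)

lemma prod_minus_eq_fact:
  assumes "r \<le> n"
  shows "(\<Prod>i=0..<r. n - i) * fact (n - r) = (fact n :: nat)"
  using assms
proof (induction r)
  case (Suc r)
  then have "n - r = Suc (n - Suc r)" by simp
  then have "(n - r) * fact (n - Suc r) = (fact (n - r) :: nat)"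
    by (metis fact_Suc of_nat_id)
  with Suc show ?case by (simp add: mult.assoc)
qed simp

text \<open>The product form avoids division; it is what later cancels the factorial in the Poisson
  weights.\<close>

lemma card_injs:
  assumes "finite x" "r \<le> card x"
  shows "card (injs r x) * fact (card x - r) = fact (card x)"
  using card_inj_on_subset_funcset[of "{..<r}" x "{..<r}"] assms prod_minus_eq_fact[of r "card x"]
  by (simp add: injs_def)

lemma injs_empty:
  assumes "finite x" "card x < r"
  shows "injs r x = {}"
proof -
  have False if "z \<in> injs r x" for z
    using that assms card_inj_on_le[of z "{..<r}" x] by (auto simp: injs_def)
  then show ?thesis by blast
qed

text \<open>Replaces tuples of points by tuples of indices. The new index set does not depend on
  \<open>z\<close>, so a sum over it can be exchanged with an integral over
  \<open>z\<close>.\<close>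

lemma bij_betw_injs_image:
  assumes "inj_on z {..<n}"
  shows "bij_betw (\<lambda>\<iota>. restrict (z \<circ> \<iota>) {..<r}) (injs r {..<n}) (injs r (z ` {..<n}))"
proof (rule bij_betw_byWitness[where f' = "\<lambda>y. restrict (inv_into {..<n} z \<circ> y) {..<r}"])
  show "\<forall>\<iota>\<in>injs r {..<n}. restrict (inv_into {..<n} z \<circ> restrict (z \<circ> \<iota>) {..<r}) {..<r} = \<iota>"
    using assms by (auto simp: injs_def fun_eq_iff PiE_iff extensional_def restrict_def inv_into_f_f)
  show "\<forall>y\<in>injs r (z ` {..<n}). restrict (z \<circ> restrict (inv_into {..<n} z \<circ> y) {..<r}) {..<r} = y"
    by (auto simp: injs_def fun_eq_iff PiE_iff extensional_def restrict_def f_inv_into_f)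
  show "(\<lambda>\<iota>. restrict (z \<circ> \<iota>) {..<r}) ` injs r {..<n} \<subseteq> injs r (z ` {..<n})"
    using assms by (auto simp: injs_def PiE_iff inj_on_def)
  show "(\<lambda>y. restrict (inv_into {..<n} z \<circ> y) {..<r}) ` injs r (z ` {..<n}) \<subseteq> injs r {..<n}"
  proof (intro subsetI)
    fix t assume "t \<in> (\<lambda>y. restrict (inv_into {..<n} z \<circ> y) {..<r}) ` injs r (z ` {..<n})"
    then obtain y where y: "y \<in> PiE {..<r} (\<lambda>_. z ` {..<n})" "inj_on y {..<r}"
      and t: "t = restrict (inv_into {..<n} z \<circ> y) {..<r}"
      by (auto simp: injs_def)
    have "inj_on (inv_into {..<n} z \<circ> y) {..<r}"
      using y by (intro comp_inj_on inj_on_inv_into) (auto simp: PiE_iff)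
    moreover have "inv_into {..<n} z (y i) \<in> {..<n}" if "i < r" for i
      using y that by (intro inv_into_into) (auto simp: PiE_iff)
    ultimately show "t \<in> injs r {..<n}"
      unfolding t injs_def by auto
  qed
qed

section \<open>Coincidence patterns of products\<close>

text \<open>The number of strictly smaller elements is a strictly monotone rank, hence injective,
  and it stays below \<open>card S\<close> because no element counts itself. With
  \<open>h = Min\<close> this is the numbering of blocks behind \<open>bidx\<close>.\<close>

lemma bij_betw_rank:
  fixes h :: "'b \<Rightarrow> 'c::linorder"
  assumes S: "finite S" and h: "inj_on h S"
  shows "bij_betw (\<lambda>b. card {b' \<in> S. h b' < h b}) S {..<card S}"
proof -
  let ?r = "\<lambda>b. card {b' \<in> S. h b' < h b}"
  have less: "?r b < ?r b'" if "b \<in> S" "b' \<in> S" "h b < h b'" for b b'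
    using that S by (intro psubset_card_mono) auto
  have "inj_on ?r S"
  proof (rule inj_onI)
    fix b b' assume bb: "b \<in> S" "b' \<in> S" "?r b = ?r b'"
    then have "h b = h b'" using less[of b b'] less[of b' b] by (metis less_irrefl linorder_cases)
    with bb h show "b = b'" by (auto dest: inj_onD)
  qed
  moreover have "?r ` S \<subseteq> {..<card S}"
    using S by (auto intro!: psubset_card_mono)
  ultimately show ?thesis
    by (simp add: bij_betw_def card_image card_subset_eq)
qed

context
  fixes K :: nat and \<sigma> :: "nat set set"
  assumes \<sigma>: "partition_on {..<K} \<sigma>"
begin

lemma finite_blocks: "finite \<sigma>"
  using finite_elements[OF _ \<sigma>] by simp

lemma inj_on_Min_blocks: "inj_on Min \<sigma>"
proof (rule inj_onI)
  fix b b' assume b: "b \<in> \<sigma>" "b' \<in> \<sigma>" "Min b = Min b'"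
  have "Min b \<in> b" if "b \<in> \<sigma>" for b
    using that \<sigma> by (intro Min_in) (auto simp: partition_on_def intro: finite_subset[of b "{..<K}"])
  then have "Min b \<in> b \<inter> b'" using b by (metis IntI)
  then show "b = b'"
    using \<sigma> b by (auto simp: partition_on_def disjoint_def)
qed

lemma the_block:
  assumes "b \<in> \<sigma>" "j \<in> b"
  shows "(THE b. b \<in> \<sigma> \<and> j \<in> b) = b"
  using assms \<sigma> by (intro the_equality) (auto simp: partition_on_def disjoint_def)

lemma bidx_block:
  assumes "b \<in> \<sigma>" "j \<in> b"
  shows "bidx \<sigma> j = card {b' \<in> \<sigma>. Min b' < Min b}"
  unfolding bidx_def by (simp add: the_block[OF assms])

lemma block_exists:
  assumes "j < K" obtains b where "b \<in> \<sigma>" "j \<in> b"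
  using assms \<sigma> by (auto simp: partition_on_def)

text \<open>Block numbers are ranks of block minima. Disjoint blocks have distinct minima, so equal
  numbers mean equal blocks.\<close>

lemma bidx_eq_iff:
  assumes "i < K" "j < K"
  shows "bidx \<sigma> i = bidx \<sigma> j \<longleftrightarrow> (\<exists>b\<in>\<sigma>. i \<in> b \<and> j \<in> b)"
proof -
  obtain b b' where b: "b \<in> \<sigma>" "i \<in> b" "b' \<in> \<sigma>" "j \<in> b'"
    using block_exists[OF assms(1)] block_exists[OF assms(2)] .
  have "bidx \<sigma> i = bidx \<sigma> j \<longleftrightarrow> b = b'"
    using bij_betw_rank[OF finite_blocks inj_on_Min_blocks] b
    by (auto simp: bidx_block bij_betw_def dest: inj_onD)
  also have "\<dots> \<longleftrightarrow> (\<exists>b\<in>\<sigma>. i \<in> b \<and> j \<in> b)"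
  proof
    assume "\<exists>b\<in>\<sigma>. i \<in> b \<and> j \<in> b"
    then obtain d where "d \<in> \<sigma>" "i \<in> d" "j \<in> d" by blast
    then show "b = b'" using the_block[of d i] the_block[of d j] the_block[of b i] the_block[of b' j] b by simp
  qed (use b in blast)
  finally show ?thesis .
qed

lemma bidx_image: "bidx \<sigma> ` {..<K} = {..<card \<sigma>}"
proof -
  have "bidx \<sigma> ` {..<K} = (\<lambda>b. card {b' \<in> \<sigma>. Min b' < Min b}) ` \<sigma>"
  proof (intro set_eqI iffI)
    fix n assume "n \<in> bidx \<sigma> ` {..<K}"
    then obtain j where j: "j < K" "n = bidx \<sigma> j" by auto
    obtain b where "b \<in> \<sigma>" "j \<in> b" using block_exists[OF j(1)] .
    then show "n \<in> (\<lambda>b. card {b' \<in> \<sigma>. Min b' < Min b}) ` \<sigma>"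
      using j by (simp add: bidx_block)
  next
    fix n assume "n \<in> (\<lambda>b. card {b' \<in> \<sigma>. Min b' < Min b}) ` \<sigma>"
    then obtain b where b: "b \<in> \<sigma>" "n = card {b' \<in> \<sigma>. Min b' < Min b}" by auto
    have "b \<noteq> {}" "b \<subseteq> {..<K}" using b \<sigma> by (auto simp: partition_on_def)
    then obtain j where "j \<in> b" "j < K" by auto
    then show "n \<in> bidx \<sigma> ` {..<K}"
      using b by (intro image_eqI[of _ _ j]) (simp_all add: bidx_block)
  qed
  also have "\<dots> = {..<card \<sigma>}"
    using bij_betw_rank[OF finite_blocks inj_on_Min_blocks] by (simp add: bij_betw_def)
  finally show ?thesis .
qed

end

lemma offs_Suc: "offs k (Suc i) = offs k i + k i"
  by (simp add: offs_def)

lemma offs_mono: "i \<le> j \<Longrightarrow> offs k i \<le> offs k j"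
  unfolding offs_def by (intro sum_mono2) auto

lemma Jblock_subset: "i < m \<Longrightarrow> Jblock k i \<subseteq> {..<offs k m}"
  using offs_mono[of "Suc i" m k] by (auto simp: Jblock_def offs_Suc)

lemma Jblock_exists: "j < offs k m \<Longrightarrow> \<exists>i<m. j \<in> Jblock k i"
proof (induction m)
  case (Suc m)
  then show ?case
    by (cases "j < offs k m") (auto simp: Jblock_def offs_Suc intro: less_SucI)
qed (simp add: offs_def)

lemma Jblock_unique: "j \<in> Jblock k i \<Longrightarrow> j \<in> Jblock k i' \<Longrightarrow> i = i'"
  using offs_mono[of "Suc i" i' k] offs_mono[of "Suc i'" i k]
  by (cases i i' rule: linorder_cases) (auto simp: Jblock_def offs_Suc)

text \<open>These are the tuples obtained by concatenating m injective tuples: coincidences between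
  different pieces are allowed, those inside one piece are not.\<close>

definition block_inj :: "nat \<Rightarrow> (nat \<Rightarrow> nat) \<Rightarrow> 'a set \<Rightarrow> (nat \<Rightarrow> 'a) set" where
  "block_inj m k x = {Z \<in> PiE {..<offs k m} (\<lambda>_. x). \<forall>i<m. inj_on Z (Jblock k i)}"

text \<open>Every position below \<open>offs k m\<close> lies in exactly one \<open>Jblock\<close>,
  so cutting a long tuple into pieces can be undone.\<close>

lemma bij_betw_concat:
  "bij_betw (\<lambda>Z. \<lambda>i\<in>{..<m}. \<lambda>l\<in>{..<k i}. Z (offs k i + l)) (block_inj m k x)
     (PiE {..<m} (\<lambda>i. injs (k i) x))"
proof -
  define i_of where "i_of j = (SOME i. i < m \<and> j \<in> Jblock k i)" for j
  have i_of: "i_of j < m" "j \<in> Jblock k (i_of j)" if "j < offs k m" for j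
    using someI_ex[of "\<lambda>i. i < m \<and> j \<in> Jblock k i"] Jblock_exists[OF that] by (auto simp: i_of_def)
  have mem: "offs k i + l \<in> Jblock k i" if "l < k i" for i l
    using that by (simp add: Jblock_def)
  have lt: "offs k i + l < offs k m" if "i < m" "l < k i" for i l
    using Jblock_subset[OF that(1)] mem[OF that(2)] by auto
  have i_of_eq: "i_of (offs k i + l) = i" if "i < m" "l < k i" for i l
    using Jblock_unique[OF i_of(2)[OF lt[OF that]] mem[OF that(2)]] .
  \<comment> \<open>The inverse reads position \<open>j\<close> from the piece that owns it, at its
    offset within that piece.\<close>
  define glue where "glue z = (\<lambda>j\<in>{..<offs k m}. z (i_of j) (j - offs k (i_of j)))" for z :: "nat \<Rightarrow> nat \<Rightarrow> 'a"
  have off: "offs k (i_of j) + (j - offs k (i_of j)) = j" "j - offs k (i_of j) < k (i_of j)"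
    if "j < offs k m" for j
    using i_of(2)[OF that] by (auto simp: Jblock_def)
  show ?thesis
  proof (rule bij_betw_byWitness[where f' = glue])
    show "\<forall>Z\<in>block_inj m k x. glue (\<lambda>i\<in>{..<m}. \<lambda>l\<in>{..<k i}. Z (offs k i + l)) = Z"
      using i_of off by (auto simp: glue_def block_inj_def fun_eq_iff PiE_iff extensional_def)
    show "\<forall>z\<in>PiE {..<m} (\<lambda>i. injs (k i) x). (\<lambda>i\<in>{..<m}. \<lambda>l\<in>{..<k i}. glue z (offs k i + l)) = z"
    proof
      fix z assume z: "z \<in> PiE {..<m} (\<lambda>i. injs (k i) x)"
      have "(\<lambda>l\<in>{..<k i}. glue z (offs k i + l)) = z i" if "i < m" for i
      proof -
        have "z i \<in> extensional {..<k i}" using z that by (auto simp: injs_def PiE_iff)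
        then show ?thesis
          using that by (auto simp: glue_def lt i_of_eq extensional_def)
      qed
      then show "(\<lambda>i\<in>{..<m}. \<lambda>l\<in>{..<k i}. glue z (offs k i + l)) = z"
        using z by (auto simp: PiE_iff extensional_def)
    qed
    show "(\<lambda>Z. \<lambda>i\<in>{..<m}. \<lambda>l\<in>{..<k i}. Z (offs k i + l)) ` block_inj m k x \<subseteq> PiE {..<m} (\<lambda>i. injs (k i) x)"
    proof clarify
      fix Z assume Z: "Z \<in> block_inj m k x"
      have "(\<lambda>l\<in>{..<k i}. Z (offs k i + l)) \<in> injs (k i) x" if "i < m" for i
      proof -
        have inj: "inj_on Z (Jblock k i)" and "Z \<in> PiE {..<offs k m} (\<lambda>_. x)"
          using Z that by (auto simp: block_inj_def)
        then show ?thesis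
          using lt[OF that] inj_onD[OF inj _ mem mem] by (auto simp: injs_def PiE_iff intro!: inj_onI)
      qed
      then show "(\<lambda>i\<in>{..<m}. \<lambda>l\<in>{..<k i}. Z (offs k i + l)) \<in> PiE {..<m} (\<lambda>i. injs (k i) x)"
        by auto
    qed
    show "glue ` PiE {..<m} (\<lambda>i. injs (k i) x) \<subseteq> block_inj m k x"
    proof clarify
      fix z assume z: "z \<in> PiE {..<m} (\<lambda>i. injs (k i) x)"
      then have zi: "z i \<in> injs (k i) x" if "i < m" for i using that by auto
      have "glue z j \<in> x" if "j < offs k m" for j
        using zi[OF i_of(1)[OF that]] off[OF that] that by (auto simp: glue_def injs_def PiE_iff)
      moreover have "inj_on (glue z) (Jblock k i)" if i: "i < m" for i
      proof (rule inj_onI)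
        fix j j' assume j: "j \<in> Jblock k i" "j' \<in> Jblock k i" and eq: "glue z j = glue z j'"
        have l: "j = offs k i + (j - offs k i)" "j - offs k i < k i"
          "j' = offs k i + (j' - offs k i)" "j' - offs k i < k i"
          using j by (auto simp: Jblock_def)
        have "glue z j = z i (j - offs k i)" "glue z j' = z i (j' - offs k i)"
          using Jblock_subset[OF i] j i_of_eq[OF i l(2)] i_of_eq[OF i l(4)] l by (auto simp: glue_def)
        with eq zi[OF i] l show "j = j'"
          by (metis (mono_tags, lifting) injs_def inj_onD lessThan_iff mem_Collect_eq)
      qed
      ultimately show "glue z \<in> block_inj m k x"
        by (auto simp: block_inj_def glue_def)
    qed
  qed
qed

text \<open>The pattern of a long tuple \<open>Z\<close> is the quotient of its index set by the
  relation \<open>Z i = Z j\<close>; its distinct values, numbered by blocks, form the injective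
  map. Injectivity of \<open>Z\<close> on each \<open>Jblock\<close> says exactly that no block of
  the pattern meets it twice.\<close>

lemma bij_betw_kernel:
  "bij_betw (\<lambda>(\<sigma>, y). \<lambda>j\<in>{..<offs k m}. y (bidx \<sigma> j))
     (SIGMA \<sigma>:Pi_part m k. injs (card \<sigma>) x) (block_inj m k x)"
proof (rule bij_betwI')
  let ?K = "offs k m"
  let ?Z = "\<lambda>(\<sigma>, y). \<lambda>j\<in>{..<?K}. y (bidx \<sigma> j)"
  have part: "partition_on {..<?K} \<sigma>" if "\<sigma> \<in> Pi_part m k" for \<sigma>
    using that by (simp add: Pi_part_def)
  have bidx_lt: "bidx \<sigma> j < card \<sigma>" if "\<sigma> \<in> Pi_part m k" "j < ?K" for \<sigma> j
    using bidx_image[OF part[OF that(1)]] that(2) by auto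
  have ker: "y (bidx \<sigma> i) = y (bidx \<sigma> j) \<longleftrightarrow> (\<exists>b\<in>\<sigma>. i \<in> b \<and> j \<in> b)"
    if "\<sigma> \<in> Pi_part m k" "y \<in> injs (card \<sigma>) x" "i < ?K" "j < ?K" for \<sigma> y i j
  proof -
    have "inj_on y {..<card \<sigma>}" using that(2) by (simp add: injs_def)
    then have "y (bidx \<sigma> i) = y (bidx \<sigma> j) \<longleftrightarrow> bidx \<sigma> i = bidx \<sigma> j"
      using bidx_lt[OF that(1)] that(3,4) by (intro inj_on_eq_iff) auto
    then show ?thesis using bidx_eq_iff[OF part[OF that(1)] that(3,4)] by simp
  qed
  show "?Z a = ?Z b \<longleftrightarrow> a = b"
    if a: "a \<in> (SIGMA \<sigma>:Pi_part m k. injs (card \<sigma>) x)" and b: "b \<in> (SIGMA \<sigma>:Pi_part m k. injs (card \<sigma>) x)"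
    for a b
  proof
    assume eq: "?Z a = ?Z b"
    obtain \<sigma> y \<tau> w where ab: "a = (\<sigma>, y)" "b = (\<tau>, w)" by (cases a, cases b)
    have \<sigma>: "\<sigma> \<in> Pi_part m k" "y \<in> injs (card \<sigma>) x" and \<tau>: "\<tau> \<in> Pi_part m k" "w \<in> injs (card \<tau>) x"
      using a b ab by auto
    have yw: "y (bidx \<sigma> j) = w (bidx \<tau> j)" if "j < ?K" for j
      using fun_cong[OF eq, of j] that by (simp add: ab)
    \<comment> \<open>Both partitions have the coincidence relation of the common tuple as their
      equivalence relation, and a partition is recovered from it as a quotient.\<close>
    have "{(i, j). \<exists>b\<in>\<sigma>. i \<in> b \<and> j \<in> b} = {(i, j). i < ?K \<and> j < ?K \<and> y (bidx \<sigma> i) = y (bidx \<sigma> j)}"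
      using ker[OF \<sigma>] part[OF \<sigma>(1)] by (auto simp: partition_on_def)
    also have "\<dots> = {(i, j). i < ?K \<and> j < ?K \<and> w (bidx \<tau> i) = w (bidx \<tau> j)}"
      using yw by auto
    also have "\<dots> = {(i, j). \<exists>b\<in>\<tau>. i \<in> b \<and> j \<in> b}"
      using ker[OF \<tau>] part[OF \<tau>(1)] by (auto simp: partition_on_def)
    finally have st: "\<sigma> = \<tau>"
      using partition_on_eq_quotient[OF part[OF \<sigma>(1)]] partition_on_eq_quotient[OF part[OF \<tau>(1)]] by metis
    have "y i = w i" for i
    proof (cases "i < card \<sigma>")
      case True
      then obtain j where "j < ?K" "i = bidx \<sigma> j"
        using bidx_image[OF part[OF \<sigma>(1)]] by (metis imageE lessThan_iff)
      then show ?thesis using yw st by auto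
    next
      case False
      then show ?thesis using \<sigma> \<tau> st by (auto simp: injs_def PiE_iff extensional_def)
    qed
    then show "a = b" using ab st by auto
  qed auto
  show "?Z a \<in> block_inj m k x" if a: "a \<in> (SIGMA \<sigma>:Pi_part m k. injs (card \<sigma>) x)" for a
  proof -
    obtain \<sigma> y where ay: "a = (\<sigma>, y)" by (cases a)
    have \<sigma>: "\<sigma> \<in> Pi_part m k" "y \<in> injs (card \<sigma>) x" using a ay by auto
    have "inj_on (?Z a) (Jblock k i)" if i: "i < m" for i
    proof (rule inj_onI)
      fix j j' assume j: "j \<in> Jblock k i" "j' \<in> Jblock k i" and eq: "?Z a j = ?Z a j'"
      have jK: "j < ?K" "j' < ?K" using Jblock_subset[OF i] j by auto
      then obtain b where b: "b \<in> \<sigma>" "j \<in> b" "j' \<in> b"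
        using eq ker[OF \<sigma> jK] by (auto simp: ay)
      have "card (b \<inter> Jblock k i) \<le> Suc 0" using \<sigma> b i by (simp add: Pi_part_def)
      then show "j = j'"
        using b j card_le_Suc0_iff_eq[of "b \<inter> Jblock k i"] by (auto simp: Jblock_def)
    qed
    moreover have "?Z a \<in> PiE {..<?K} (\<lambda>_. x)"
      using \<sigma> bidx_lt[OF \<sigma>(1)] by (auto simp: ay injs_def PiE_iff)
    ultimately show ?thesis by (simp add: block_inj_def)
  qed
  show "\<exists>a\<in>(SIGMA \<sigma>:Pi_part m k. injs (card \<sigma>) x). Z = ?Z a" if Z: "Z \<in> block_inj m k x" for Z
  proof -
    define R where "R = {(i, j). i < ?K \<and> j < ?K \<and> Z i = Z j}"
    define \<sigma> where "\<sigma> = {..<?K} // R"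
    have R: "equiv {..<?K} R"
      by (auto simp: R_def equiv_def refl_on_def sym_def trans_def)
    have \<sigma>_part: "partition_on {..<?K} \<sigma>"
      unfolding \<sigma>_def by (rule partition_on_quotient[OF R])
    have same: "(\<exists>b\<in>\<sigma>. i \<in> b \<and> j \<in> b) \<longleftrightarrow> Z i = Z j" if "i < ?K" "j < ?K" for i j
    proof
      assume "\<exists>b\<in>\<sigma>. i \<in> b \<and> j \<in> b"
      then show "Z i = Z j" by (auto simp: \<sigma>_def R_def quotient_def)
    next
      assume "Z i = Z j"
      with that have "R `` {i} \<in> \<sigma>" "i \<in> R `` {i}" "j \<in> R `` {i}"
        by (auto simp: \<sigma>_def R_def quotient_def)
      then show "\<exists>b\<in>\<sigma>. i \<in> b \<and> j \<in> b" by blast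
    qed
    have "card (b \<inter> Jblock k i) \<le> 1" if "b \<in> \<sigma>" "i < m" for b i
    proof -
      have "\<forall>j\<in>b \<inter> Jblock k i. \<forall>j'\<in>b \<inter> Jblock k i. j = j'"
      proof (intro ballI)
        fix j j' assume j: "j \<in> b \<inter> Jblock k i" "j' \<in> b \<inter> Jblock k i"
        then have "j < ?K" "j' < ?K" using Jblock_subset[OF that(2)] by auto
        then have "Z j = Z j'" using same j that by blast
        then show "j = j'" using Z j that(2) by (auto simp: block_inj_def dest: inj_onD)
      qed
      then show ?thesis
        using card_le_Suc0_iff_eq[of "b \<inter> Jblock k i"] by (simp add: Jblock_def)
    qed
    then have \<sigma>: "\<sigma> \<in> Pi_part m k" using \<sigma>_part by (auto simp: Pi_part_def)
    \<comment> \<open>Any representative of the block serves, since \<open>Z\<close> is constant on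
      blocks; the restriction makes \<open>y\<close> extensional, as \<open>injs\<close>
      demands.\<close>
    define y where "y = (\<lambda>n\<in>{..<card \<sigma>}. Z (SOME j. j < ?K \<and> bidx \<sigma> j = n))"
    have y_bidx: "y (bidx \<sigma> j) = Z j" if "j < ?K" for j
    proof -
      let ?j = "SOME j'. j' < ?K \<and> bidx \<sigma> j' = bidx \<sigma> j"
      have j': "?j < ?K \<and> bidx \<sigma> ?j = bidx \<sigma> j" by (rule someI[of _ j]) (simp add: that)
      then have "Z ?j = Z j"
        using bidx_eq_iff[OF \<sigma>_part, of ?j j] same[of ?j j] that by blast
      then show ?thesis using bidx_lt[OF \<sigma> that] by (simp add: y_def)
    qed
    have y_ex: "\<exists>j<?K. n = bidx \<sigma> j \<and> y n = Z j" if "n < card \<sigma>" for n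
      using bidx_image[OF \<sigma>_part] that y_bidx by (metis imageE lessThan_iff)
    have "y \<in> injs (card \<sigma>) x"
    proof -
      have "y n \<in> x" if "n < card \<sigma>" for n
        using y_ex[OF that] Z by (auto simp: block_inj_def PiE_iff)
      moreover have "inj_on y {..<card \<sigma>}"
      proof (rule inj_onI)
        fix n n' assume "n \<in> {..<card \<sigma>}" "n' \<in> {..<card \<sigma>}" and eq: "y n = y n'"
        then obtain j j' where j: "j < ?K" "n = bidx \<sigma> j" "y n = Z j" "j' < ?K" "n' = bidx \<sigma> j'" "y n' = Z j'"
          using y_ex by (metis lessThan_iff)
        then show "n = n'"
          using bidx_eq_iff[OF \<sigma>_part, of j j'] same[of j j'] eq by metis
      qed
      ultimately show ?thesis by (auto simp: injs_def y_def)
    qed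
    moreover have "Z = ?Z (\<sigma>, y)"
      using Z y_bidx by (auto simp: block_inj_def PiE_iff extensional_def)
    ultimately show ?thesis using \<sigma> by blast
  qed
qed

lemma finite_Pi_part: "finite (Pi_part m k)"
  using finitely_many_partition_on[of "{..<offs k m}"] by (simp add: Pi_part_def)

text \<open>The product of sums expands into a sum over families of tuples; gluing each family and
  then separating pattern from values reindexes it.\<close>

lemma prod_ustat_eq_sum_partitions:
  assumes "finite x"
  shows "(\<Prod>i<m. ustat (k i) (f i) x)
    = (\<Sum>\<sigma>\<in>Pi_part m k. \<Sum>y\<in>injs (card \<sigma>) x. tensor_sigma m k f \<sigma> y)"
proof -
  have lt: "offs k i + l < offs k m" if "i < m" "l < k i" for i l
    using Jblock_subset[OF that(1), of k] that(2) by (metis Jblock_def atLeastLessThan_iff le_add1 lessThan_iff nat_add_left_cancel_less subsetD)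
  have "(\<Prod>i<m. ustat (k i) (f i) x) = (\<Sum>z\<in>PiE {..<m} (\<lambda>i. injs (k i) x). \<Prod>i<m. f i (z i))"
    unfolding ustat_injs using finite_injs[OF assms] by (intro prod_sum_PiE) auto
  also have "\<dots> = (\<Sum>Z\<in>block_inj m k x. \<Prod>i<m. f i (\<lambda>l\<in>{..<k i}. Z (offs k i + l)))"
    by (subst sum.reindex_bij_betw[OF bij_betw_concat, symmetric]) simp
  also have "\<dots> = (\<Sum>(\<sigma>, y)\<in>(SIGMA \<sigma>:Pi_part m k. injs (card \<sigma>) x). tensor_sigma m k f \<sigma> y)"
    by (subst sum.reindex_bij_betw[OF bij_betw_kernel, symmetric])
      (auto simp: tensor_sigma_def lt intro!: sum.cong prod.cong arg_cong[of _ _ "f _"] restrict_ext)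
  also have "\<dots> = (\<Sum>\<sigma>\<in>Pi_part m k. \<Sum>y\<in>injs (card \<sigma>) x. tensor_sigma m k f \<sigma> y)"
    using finite_Pi_part finite_injs[OF assms] by (subst sum.Sigma) auto
  finally show ?thesis .
qed

section \<open>Products of two symmetric statistics\<close>

text \<open>Between finite sets of equal size the injections are the bijections; extensionality
  keeps different values outside \<open>I\<close> from being counted.\<close>

lemma card_bij_betw_extensional:
  assumes "finite I" "finite D" "card I = card D"
  shows "card {z \<in> extensional I. bij_betw z I D} = fact (card I)"
proof -
  have "{z \<in> extensional I. bij_betw z I D} = {z \<in> I \<rightarrow>\<^sub>E D. inj_on z I}"
  proof (intro set_eqI iffI)
    fix z assume "z \<in> {z \<in> I \<rightarrow>\<^sub>E D. inj_on z I}"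
    then have z: "z \<in> extensional I" "z ` I \<subseteq> D" "inj_on z I" by (auto simp: PiE_iff)
    then have "z ` I = D" using assms by (intro card_subset_eq) (auto simp: card_image)
    with z show "z \<in> {z \<in> extensional I. bij_betw z I D}" by (simp add: bij_betw_def)
  qed (auto simp: bij_betw_def PiE_iff)
  also have "card \<dots> = fact (card I)"
    using card_inj_on_subset_funcset[of I D I] prod_minus_eq_fact[of "card I" "card I"] assms by simp
  finally show ?thesis .
qed

text \<open>Two injective enumerations of the same set differ by the permutation that sends
  \<open>i\<close> to the \<open>z\<close>-index of \<open>w i\<close>.\<close>

lemma symmetric_eq_of_image_eq:
  assumes sym: "\<And>\<pi> z. \<pi> permutes {..<k} \<Longrightarrow> z \<in> PiE {..<k} (\<lambda>_. B) \<Longrightarrow> f (z \<circ> \<pi>) = f z"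
    and z: "z \<in> injs k B" and w: "w \<in> injs k B" and im: "z ` {..<k} = w ` {..<k}"
  shows "f z = f w"
proof -
  define \<pi> where "\<pi> i = (if i < k then inv_into {..<k} z (w i) else i)" for i
  have "bij_betw (inv_into {..<k} z) (z ` {..<k}) {..<k}"
    using z by (intro bij_betw_inv_into) (auto simp: injs_def bij_betw_def)
  moreover have "bij_betw w {..<k} (z ` {..<k})"
    using w im by (auto simp: injs_def bij_betw_def)
  ultimately have "bij_betw (inv_into {..<k} z \<circ> w) {..<k} {..<k}"
    by (rule bij_betw_trans[rotated])
  then have "bij_betw \<pi> {..<k} {..<k}"
    by (rule bij_betw_cong[THEN iffD1, rotated]) (simp add: \<pi>_def)
  then have "\<pi> permutes {..<k}"
    by (rule bij_imp_permutes) (simp add: \<pi>_def)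
  moreover have "z \<circ> \<pi> = w"
  proof
    fix i
    show "(z \<circ> \<pi>) i = w i"
    proof (cases "i < k")
      case True
      then have "w i \<in> z ` {..<k}" using im by auto
      with True show ?thesis by (simp add: \<pi>_def f_inv_into_f)
    next
      \<comment> \<open>Beyond \<open>k\<close> the permutation is the identity and both tuples are
        \<open>undefined\<close>, so the functions agree everywhere.\<close>
      case False
      then show ?thesis using z w by (simp add: \<pi>_def injs_def PiE_iff extensional_def)
    qed
  qed
  ultimately show ?thesis using sym[of \<pi> z] z by (auto simp: injs_def)
qed

text \<open>On injective tuples a symmetric kernel is a function of the point set, which reduces the
  product of two statistics to counting pairs of subsets.\<close>

lemma symmetric_factors_through_image:
  assumes "\<And>\<pi> z. \<pi> permutes {..<k} \<Longrightarrow> z \<in> PiE {..<k} (\<lambda>_. B) \<Longrightarrow> f (z \<circ> \<pi>) = f z"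
  obtains \<phi> where "\<And>z. z \<in> injs k B \<Longrightarrow> f z = \<phi> (z ` {..<k})"
proof
  fix z assume z: "z \<in> injs k B"
  let ?w = "SOME w. w \<in> injs k B \<and> w ` {..<k} = z ` {..<k}"
  have "?w \<in> injs k B \<and> ?w ` {..<k} = z ` {..<k}"
    by (rule someI[of _ z]) (simp add: z)
  then show "f z = (\<lambda>A. f (SOME w. w \<in> injs k B \<and> w ` {..<k} = A)) (z ` {..<k})"
    using symmetric_eq_of_image_eq[of k B f z ?w] assms z by simp
qed

lemma sum_injs_image:
  fixes G :: "'a set \<Rightarrow> real"
  assumes x: "finite x"
  shows "(\<Sum>z\<in>injs k x. G (z ` {..<k})) = fact k * (\<Sum>A | A \<subseteq> x \<and> card A = k. G A)"
proof -
  let ?T = "{A. A \<subseteq> x \<and> card A = k}"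
  have fibre: "{z. z \<in> injs k x \<and> z ` {..<k} = A} = {z \<in> extensional {..<k}. bij_betw z {..<k} A}"
    if "A \<in> ?T" for A
    using that by (auto simp: injs_def bij_betw_def PiE_iff)
  have "(\<Sum>z\<in>injs k x. G (z ` {..<k}))
      = (\<Sum>A\<in>?T. \<Sum>z | z \<in> injs k x \<and> z ` {..<k} = A. G (z ` {..<k}))"
    using x by (intro sum.group[symmetric] finite_injs) (auto simp: injs_def PiE_iff card_image)
  also have "\<dots> = (\<Sum>A\<in>?T. fact k * G A)"
  proof (rule sum.cong[OF refl])
    fix A assume A: "A \<in> ?T"
    then have "card {z \<in> extensional {..<k}. bij_betw z {..<k} A} = fact k"
      using card_bij_betw_extensional[of "{..<k}" A] finite_subset[OF _ x] by auto
    then show "(\<Sum>z | z \<in> injs k x \<and> z ` {..<k} = A. G (z ` {..<k})) = fact k * G A"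
      by (simp add: fibre[OF A, symmetric])
  qed
  finally show ?thesis by (simp add: sum_distrib_left)
qed

text \<open>Here \<open>I1\<close> holds the shared indices, \<open>I2\<close> those used only for
  \<open>C\<close> and \<open>I3\<close> those used only for \<open>A\<close>. An injective map
  commutes with intersection and difference, so prescribing both images forces \<open>I1\<close>,
  \<open>I2\<close>, \<open>I3\<close> onto \<open>A \<inter> C\<close>, \<open>C - A\<close>,
  \<open>A - C\<close>; the three bijections are then free.\<close>

lemma card_inj_two_images:
  assumes I: "finite I1" "finite I2" "finite I3" "I1 \<inter> I2 = {}" "I1 \<inter> I3 = {}" "I2 \<inter> I3 = {}"
    and AC: "finite A" "finite C" "card (A \<inter> C) = card I1" "card (C - A) = card I2" "card (A - C) = card I3"
  shows "card {y \<in> extensional (I1 \<union> I2 \<union> I3). inj_on y (I1 \<union> I2 \<union> I3) \<and>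
      y ` (I1 \<union> I3) = A \<and> y ` (I1 \<union> I2) = C} = fact (card I1) * fact (card I2) * fact (card I3)"
    (is "card ?Y = _")
proof -
  let ?N = "I1 \<union> I2 \<union> I3"
  let ?b = "\<lambda>I D. {z \<in> extensional I. bij_betw z I D}"
  let ?split = "\<lambda>y. (restrict y I1, restrict y I2, restrict y I3)"
  define glue where
    "glue = (\<lambda>(u, v, w) i. if i \<in> I1 then u i else if i \<in> I2 then v i else if i \<in> I3 then w i else undefined :: 'b)"
  have "bij_betw ?split ?Y (?b I1 (A \<inter> C) \<times> ?b I2 (C - A) \<times> ?b I3 (A - C))"
  proof (rule bij_betw_byWitness[where f' = glue])
    show "\<forall>y\<in>?Y. glue (?split y) = y"
      by (auto simp: glue_def fun_eq_iff extensional_def)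
    show "\<forall>t\<in>?b I1 (A \<inter> C) \<times> ?b I2 (C - A) \<times> ?b I3 (A - C). ?split (glue t) = t"
      using I by (auto simp: glue_def fun_eq_iff extensional_def restrict_def)
    show "?split ` ?Y \<subseteq> ?b I1 (A \<inter> C) \<times> ?b I2 (C - A) \<times> ?b I3 (A - C)"
    proof (rule image_subsetI)
      fix y assume y: "y \<in> ?Y"
      then have inj: "inj_on y ?N" by simp
      let ?A = "y ` (I1 \<union> I3)" and ?C = "y ` (I1 \<union> I2)"
      have "y ` I1 = ?A \<inter> ?C"
        using inj I by (subst inj_on_image_Int[OF inj, symmetric]) (auto intro!: arg_cong[of _ _ "image y"])
      moreover have "y ` I2 = ?C - ?A"
        using inj I by (subst inj_on_image_set_diff[OF inj, symmetric]) (auto intro!: arg_cong[of _ _ "image y"])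
      moreover have "y ` I3 = ?A - ?C"
        using inj I by (subst inj_on_image_set_diff[OF inj, symmetric]) (auto intro!: arg_cong[of _ _ "image y"])
      moreover have "?A = A" "?C = C" using y by auto
      ultimately have "y ` I1 = A \<inter> C" "y ` I2 = C - A" "y ` I3 = A - C" by simp_all
      then show "?split y \<in> ?b I1 (A \<inter> C) \<times> ?b I2 (C - A) \<times> ?b I3 (A - C)"
        using inj by (auto simp: bij_betw_def inj_on_restrict_eq intro: inj_on_subset)
    qed
    show "glue ` (?b I1 (A \<inter> C) \<times> ?b I2 (C - A) \<times> ?b I3 (A - C)) \<subseteq> ?Y"
    proof (rule image_subsetI)
      fix t assume "t \<in> ?b I1 (A \<inter> C) \<times> ?b I2 (C - A) \<times> ?b I3 (A - C)"
      then obtain u v w where t: "t = (u, v, w)"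
        and uvw: "bij_betw u I1 (A \<inter> C)" "bij_betw v I2 (C - A)" "bij_betw w I3 (A - C)"
        by auto
      let ?y = "glue (u, v, w)"
      have b: "bij_betw ?y I1 (A \<inter> C)" "bij_betw ?y I2 (C - A)" "bij_betw ?y I3 (A - C)"
        by (subst bij_betw_cong[of _ _ u] bij_betw_cong[of _ _ v] bij_betw_cong[of _ _ w],
            use I in \<open>auto simp: glue_def\<close>, rule uvw)+
      have "bij_betw ?y (I1 \<union> I2 \<union> I3) ((A \<inter> C) \<union> (C - A) \<union> (A - C))"
        by (intro bij_betw_combine b) auto
      moreover have "?y ` (I1 \<union> I3) = A" "?y ` (I1 \<union> I2) = C"
        using b by (auto simp: bij_betw_def image_Un)
      moreover have "?y \<in> extensional ?N" by (auto simp: glue_def extensional_def)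
      ultimately show "glue t \<in> ?Y"
        by (simp add: bij_betw_def t)
    qed
  qed
  then have "card ?Y = card (?b I1 (A \<inter> C) \<times> ?b I2 (C - A) \<times> ?b I3 (A - C))"
    by (rule bij_betw_same_card)
  also have "\<dots> = fact (card I1) * fact (card I2) * fact (card I3)"
    using I AC by (simp add: card_cartesian_product card_bij_betw_extensional)
  finally show ?thesis .
qed

text \<open>\<open>j\<close> is the number of points of \<open>C\<close> outside \<open>A\<close>,
  so the union has \<open>n + j\<close> points. The index set splits as in \<open>h_fun\<close>:
  first the \<open>l - j\<close> shared positions, then \<open>j\<close> positions for
  \<open>C\<close> alone, then \<open>n - l + j\<close> for \<open>A\<close> alone. The constant
  counts the enumerations of one pair compatible with this layout.\<close>

lemma sum_injs_two_images:
  fixes G :: "'a set \<Rightarrow> 'a set \<Rightarrow> real"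
  assumes x: "finite x" and j: "j \<le> l" "l \<le> n"
  shows "(\<Sum>y\<in>injs (n + j) x. G (y ` ({..<l - j} \<union> {l..<n + j})) (y ` {..<l}))
    = fact (l - j) * fact j * fact (n - l + j) *
      (\<Sum>(A, C) | A \<subseteq> x \<and> C \<subseteq> x \<and> card A = n \<and> card C = l \<and> card (A \<inter> C) = l - j. G A C)"
proof -
  let ?I1 = "{..<l - j}" and ?I2 = "{l - j..<l}" and ?I3 = "{l..<n + j}"
  let ?T = "{(A, C). A \<subseteq> x \<and> C \<subseteq> x \<and> card A = n \<and> card C = l \<and> card (A \<inter> C) = l - j}"
  let ?m = "\<lambda>y. (y ` (?I1 \<union> ?I3), y ` {..<l})"
  have N: "?I1 \<union> ?I2 = {..<l}" "{..<l} \<union> ?I3 = {..<n + j}"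
    using j by auto
  have disj: "?I1 \<inter> ?I2 = {}" "?I1 \<inter> ?I3 = {}" "?I2 \<inter> ?I3 = {}" by auto
  have cardI: "card ?I1 = l - j" "card ?I2 = j" "card ?I3 = n - l + j"
    using j by auto
  have card13: "card (?I1 \<union> ?I3) = n"
    using j by (subst card_Un_disjoint[OF _ _ disj(2)]) auto
  have finT: "finite ?T"
    using x by (intro finite_subset[of ?T "Pow x \<times> Pow x"]) auto
  have into: "?m ` injs (n + j) x \<subseteq> ?T"
  proof (rule image_subsetI)
    fix y assume y: "y \<in> injs (n + j) x"
    then have inj: "inj_on y {..<n + j}" and yx: "y ` {..<n + j} \<subseteq> x" by (auto simp: injs_def PiE_iff)
    have sub: "?I1 \<union> ?I3 \<subseteq> {..<n + j}" "{..<l} \<subseteq> {..<n + j}" using j by auto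
    have "y ` (?I1 \<union> ?I3) \<inter> y ` {..<l} = y ` ?I1"
      using j by (subst inj_on_image_Int[OF inj sub, symmetric]) (auto intro!: arg_cong[of _ _ "image y"])
    moreover have "card (y ` (?I1 \<union> ?I3)) = n"
      using card_image[OF inj_on_subset[OF inj sub(1)]] card13 by simp
    moreover have "card (y ` ?I1) = l - j" "card (y ` {..<l}) = l"
      using card_image[OF inj_on_subset[OF inj, of ?I1]] card_image[OF inj_on_subset[OF inj sub(2)]] j by auto
    moreover have "y ` (?I1 \<union> ?I3) \<subseteq> x" "y ` {..<l} \<subseteq> x"
      using order_trans[OF image_mono[OF sub(1)] yx] order_trans[OF image_mono[OF sub(2)] yx] .
    ultimately show "?m y \<in> ?T" by (simp only: mem_Collect_eq case_prod_conv simp_thms)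
  qed
  have fibre: "card {y. y \<in> injs (n + j) x \<and> ?m y = t} = fact (l - j) * fact j * fact (n - l + j)"
    if "t \<in> ?T" for t
  proof -
    obtain A C where t: "t = (A, C)" by (cases t)
    have AC: "A \<subseteq> x" "C \<subseteq> x" "card A = n" "card C = l" "card (A \<inter> C) = l - j" using that t by auto
    have fin: "finite A" "finite C" using AC finite_subset[OF _ x] by auto
    have "card (C - A) = j" "card (A - C) = n - l + j"
      using card_Diff_subset_Int[of C A] card_Diff_subset_Int[of A C] fin AC j by (auto simp: Int_commute)
    moreover have "{y. y \<in> injs (n + j) x \<and> ?m y = t} = {y \<in> extensional (?I1 \<union> ?I2 \<union> ?I3).
        inj_on y (?I1 \<union> ?I2 \<union> ?I3) \<and> y ` (?I1 \<union> ?I3) = A \<and> y ` (?I1 \<union> ?I2) = C}"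
      unfolding N
    proof (rule Collect_cong)
      fix y
      have U: "{..<n + j} = (?I1 \<union> ?I3) \<union> {..<l}" using j by auto
      have injs_iff: "y \<in> injs (n + j) x
          \<longleftrightarrow> y \<in> extensional {..<n + j} \<and> inj_on y {..<n + j} \<and> y ` {..<n + j} \<subseteq> x"
        unfolding injs_def PiE_iff image_subset_iff mem_Collect_eq by blast
      have "y ` {..<n + j} = y ` (?I1 \<union> ?I3) \<union> y ` {..<l}"
        by (subst U) (rule image_Un)
      then show "y \<in> injs (n + j) x \<and> ?m y = t \<longleftrightarrow> y \<in> extensional {..<n + j} \<and>
          inj_on y {..<n + j} \<and> y ` (?I1 \<union> ?I3) = A \<and> y ` {..<l} = C"
        unfolding injs_iff t prod.inject using AC(1,2) by (metis Un_least)
    qed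
    ultimately show ?thesis
      using card_inj_two_images[of ?I1 ?I2 ?I3 A C] fin AC cardI disj j by simp
  qed
  have "(\<Sum>y\<in>injs (n + j) x. G (y ` (?I1 \<union> ?I3)) (y ` {..<l}))
      = (\<Sum>t\<in>?T. \<Sum>y | y \<in> injs (n + j) x \<and> ?m y = t. G (y ` (?I1 \<union> ?I3)) (y ` {..<l}))"
    by (rule sum.group[OF finite_injs[OF x] finT into, symmetric])
  also have "\<dots> = (\<Sum>t\<in>?T. real (fact (l - j) * fact j * fact (n - l + j)) * (case t of (A, C) \<Rightarrow> G A C))"
  proof (rule sum.cong[OF refl])
    fix t assume t: "t \<in> ?T"
    have "(\<Sum>y | y \<in> injs (n + j) x \<and> ?m y = t. G (y ` (?I1 \<union> ?I3)) (y ` {..<l}))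
        = (\<Sum>y | y \<in> injs (n + j) x \<and> ?m y = t. case t of (A, C) \<Rightarrow> G A C)"
      by (rule sum.cong) auto
    then show "(\<Sum>y | y \<in> injs (n + j) x \<and> ?m y = t. G (y ` (?I1 \<union> ?I3)) (y ` {..<l}))
        = real (fact (l - j) * fact j * fact (n - l + j)) * (case t of (A, C) \<Rightarrow> G A C)"
      by (simp only: sum_constant fibre[OF t])
  qed
  finally show ?thesis by (simp add: sum_distrib_left)
qed

text \<open>A pair of an n-set \<open>A\<close> and an l-set \<open>C\<close> has n! l! enumerations
  on the left, but (l - j)! j! (n - l + j)! on the right when \<open>j\<close> points of
  \<open>C\<close> lie outside \<open>A\<close>. The ratio is the binomial coefficient times n! / (n
  - l + j)!.\<close>

lemma ustat_mult_ustat: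
  assumes x: "finite x" "x \<subseteq> B" and ln: "l \<le> n"
    and sym1: "\<And>\<pi> z. \<pi> permutes {..<n} \<Longrightarrow> z \<in> PiE {..<n} (\<lambda>_. B) \<Longrightarrow> f1 (z \<circ> \<pi>) = f1 z"
    and sym2: "\<And>\<pi> z. \<pi> permutes {..<l} \<Longrightarrow> z \<in> PiE {..<l} (\<lambda>_. B) \<Longrightarrow> f2 (z \<circ> \<pi>) = f2 z"
  shows "ustat n f1 x * ustat l f2 x
    = (\<Sum>j\<le>l. real (l choose j) * fact n / fact (n - l + j) * (\<Sum>y\<in>injs (n + j) x. h_fun n l j f1 f2 y))"
proof -
  obtain \<phi>1 where \<phi>1: "\<And>z. z \<in> injs n B \<Longrightarrow> f1 z = \<phi>1 (z ` {..<n})"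
    using symmetric_factors_through_image[of n B f1] sym1 by blast
  obtain \<phi>2 where \<phi>2: "\<And>z. z \<in> injs l B \<Longrightarrow> f2 z = \<phi>2 (z ` {..<l})"
    using symmetric_factors_through_image[of l B f2] sym2 by blast
  have injs_B: "z \<in> injs i B" if "z \<in> injs i x" for z i
    using that x by (auto simp: injs_def PiE_iff)
  let ?T = "{A. A \<subseteq> x \<and> card A = n} \<times> {C. C \<subseteq> x \<and> card C = l}"
  let ?G = "\<lambda>A C. \<phi>1 A * \<phi>2 C"
  let ?S = "\<lambda>j. \<Sum>(A, C) | A \<subseteq> x \<and> C \<subseteq> x \<and> card A = n \<and> card C = l \<and> card (A \<inter> C) = l - j. ?G A C"
  have h: "h_fun n l j f1 f2 y = ?G (y ` ({..<l - j} \<union> {l..<n + j})) (y ` {..<l})"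
    if y: "y \<in> injs (n + j) x" and j: "j \<le> l" for y j
  proof -
    have yi: "inj_on y {..<n + j}" "y \<in> PiE {..<n + j} (\<lambda>_. x)" using y by (auto simp: injs_def)
    \<comment> \<open>The positions that feed \<open>f1\<close> in \<open>h_fun\<close>: from
      \<open>l - j\<close> on, the \<open>j\<close> positions reserved for \<open>f2\<close> are
      skipped.\<close>
    let ?s = "\<lambda>i. if i < l - j then i else i + j"
    let ?z = "restrict (\<lambda>i. if i < l - j then y i else y (i + j)) {..<n}"
    have s_im: "?s ` {..<n} = {..<l - j} \<union> {l..<n + j}"
    proof (intro set_eqI iffI)
      fix i assume i: "i \<in> {..<l - j} \<union> {l..<n + j}"
      show "i \<in> ?s ` {..<n}"
      proof (cases "i < l - j")
        case True
        then show ?thesis using ln by (intro image_eqI[of _ _ i]) auto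
      next
        case False
        then show ?thesis using i j by (intro image_eqI[of _ _ "i - j"]) auto
      qed
    qed (use ln j in \<open>auto split: if_splits\<close>)
    have "inj_on ?s {..<n}" by (auto simp: inj_on_def split: if_splits)
    moreover have "inj_on y (?s ` {..<n})"
      unfolding s_im using ln j by (intro inj_on_subset[OF yi(1)]) auto
    ultimately have "inj_on (y \<circ> ?s) {..<n}" by (rule comp_inj_on)
    moreover have z_eq: "?z i = (y \<circ> ?s) i" if "i < n" for i using that by simp
    ultimately have "inj_on ?z {..<n}"
      by (subst inj_on_cong[of _ _ "y \<circ> ?s"]) auto
    then have z: "?z \<in> injs n x"
      using yi(2) by (auto simp: injs_def PiE_iff)
    have "?z ` {..<n} = (y \<circ> ?s) ` {..<n}" using z_eq by (intro image_cong) auto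
    then have z_im: "?z ` {..<n} = y ` ({..<l - j} \<union> {l..<n + j})"
      by (simp only: image_comp[symmetric] s_im)
    have w: "restrict y {..<l} \<in> injs l x"
      using yi ln by (auto simp: injs_def PiE_iff inj_on_def)
    have "f1 ?z = \<phi>1 (y ` ({..<l - j} \<union> {l..<n + j}))"
      using \<phi>1[OF injs_B[OF z]] z_im by simp
    moreover have "f2 (restrict y {..<l}) = \<phi>2 (y ` {..<l})"
      using \<phi>2[OF injs_B[OF w]] by simp
    ultimately show ?thesis by (simp add: h_fun_def)
  qed
  have "ustat n f1 x * ustat l f2 x = fact n * fact l * (\<Sum>(A, C)\<in>?T. ?G A C)"
  proof -
    have "ustat n f1 x = fact n * (\<Sum>A | A \<subseteq> x \<and> card A = n. \<phi>1 A)"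
      unfolding ustat_injs by (subst sum_injs_image[OF x(1), symmetric]) (intro sum.cong refl \<phi>1 injs_B)
    moreover have "ustat l f2 x = fact l * (\<Sum>C | C \<subseteq> x \<and> card C = l. \<phi>2 C)"
      unfolding ustat_injs by (subst sum_injs_image[OF x(1), symmetric]) (intro sum.cong refl \<phi>2 injs_B)
    ultimately show ?thesis
      by (simp add: sum_product flip: sum.cartesian_product)
  qed
  also have "(\<Sum>(A, C)\<in>?T. ?G A C) = (\<Sum>j\<le>l. ?S j)"
  proof -
    let ?c = "\<lambda>(A, C). l - card (A \<inter> C)"
    have "finite ?T" using x(1) by auto
    then have "(\<Sum>(A, C)\<in>?T. ?G A C) = (\<Sum>j\<le>l. \<Sum>t | t \<in> ?T \<and> ?c t = j. case t of (A, C) \<Rightarrow> ?G A C)"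
      by (intro sum.group[symmetric]) auto
    also have "\<dots> = (\<Sum>j\<le>l. ?S j)"
    proof (rule sum.cong[OF refl])
      fix j assume j: "j \<in> {..l}"
      \<comment> \<open>Subtraction on naturals truncates, so this equivalence rests on both
        \<open>card (A \<inter> C)\<close> and \<open>j\<close> being at most
        \<open>l\<close>.\<close>
      have "l - card (A \<inter> C) = j \<longleftrightarrow> card (A \<inter> C) = l - j" if "C \<subseteq> x" "card C = l" for A C
      proof -
        have "card (A \<inter> C) \<le> l"
          using that card_mono[of C "A \<inter> C"] finite_subset[OF _ x(1)] by auto
        with j show ?thesis by auto
      qed
      then have "{t. t \<in> ?T \<and> ?c t = j}
          = {(A, C). A \<subseteq> x \<and> C \<subseteq> x \<and> card A = n \<and> card C = l \<and> card (A \<inter> C) = l - j}"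
        by auto
      then show "(\<Sum>t | t \<in> ?T \<and> ?c t = j. case t of (A, C) \<Rightarrow> ?G A C) = ?S j"
        by (rule sum.cong) simp
    qed
    finally show ?thesis .
  qed
  also have "fact n * fact l * (\<Sum>j\<le>l. ?S j) = (\<Sum>j\<le>l. fact n * fact l * ?S j)"
    by (rule sum_distrib_left)
  also have "\<dots> = (\<Sum>j\<le>l. real (l choose j) * fact n / fact (n - l + j) * (\<Sum>y\<in>injs (n + j) x. h_fun n l j f1 f2 y))"
  proof (rule sum.cong[OF refl])
    fix j assume "j \<in> {..l}"
    then have j: "j \<le> l" by simp
    have "(\<Sum>y\<in>injs (n + j) x. h_fun n l j f1 f2 y) = fact (l - j) * fact j * fact (n - l + j) * ?S j"
      using h[OF _ j] sum_injs_two_images[OF x(1) j ln, of ?G] by simp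
    moreover have "fact j * fact (l - j) * real (l choose j) = fact l"
      using binomial_fact_lemma[OF j] by (metis of_nat_fact of_nat_mult)
    ultimately show "fact n * fact l * ?S j
        = real (l choose j) * fact n / fact (n - l + j) * (\<Sum>y\<in>injs (n + j) x. h_fun n l j f1 f2 y)"
      by (simp add: field_simps)
  qed
  finally show ?thesis .
qed

section \<open>The Poisson law as a series of product measures\<close>

lemma suminf_ennreal_shift:
  fixes f :: "nat \<Rightarrow> ennreal"
  assumes "\<And>n. n < r \<Longrightarrow> f n = 0"
  shows "(\<Sum>n. f n) = (\<Sum>n. f (n + r))"
proof -
  have "(\<Sum>i<n. f (i + r)) = (\<Sum>i<n + r. f i)" for n
    using assms by (induction n) (auto simp: add.commute)
  moreover have "(\<lambda>n. \<Sum>i<n + r. f i) \<longlonglongrightarrow> (\<Sum>n. f n)"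
    using summable_sums[OF summableI, of f] unfolding sums_def by (rule LIMSEQ_ignore_initial_segment)
  ultimately show ?thesis
    by (simp add: sums_def sums_unique)
qed

lemma suminf_swap_ennreal:
  fixes f :: "nat \<Rightarrow> nat \<Rightarrow> ennreal"
  shows "(\<Sum>i. \<Sum>j. f i j) = (\<Sum>j. \<Sum>i. f i j)"
  using nn_integral_suminf[of f "count_space UNIV"] by (simp add: nn_integral_count_space_nat)

text \<open>For indicators this is the hypothesis; linearity and monotone limits carry it to all
  nonnegative functions, the supremum passing through the series because the terms increase.\<close>

lemma nn_integral_weighted_sum_measure:
  fixes w :: "nat \<Rightarrow> ennreal"
  assumes g: "g \<in> borel_measurable M"
    and sets: "\<And>n. sets (D n) = sets M"
    and em: "\<And>S. S \<in> sets M \<Longrightarrow> emeasure M S = (\<Sum>n. w n * emeasure (D n) S)"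
  shows "(\<integral>\<^sup>+ x. g x \<partial>M) = (\<Sum>n. w n * (\<integral>\<^sup>+ x. g x \<partial>D n))"
  using g
proof (induction rule: borel_measurable_induct)
  case (cong f g)
  then have "(\<integral>\<^sup>+ x. f x \<partial>D n) = (\<integral>\<^sup>+ x. g x \<partial>D n)" for n
    by (intro nn_integral_cong) (simp add: sets_eq_imp_space_eq[OF sets])
  moreover have "(\<integral>\<^sup>+ x. f x \<partial>M) = (\<integral>\<^sup>+ x. g x \<partial>M)"
    using cong by (intro nn_integral_cong) simp
  ultimately show ?case using cong by simp
next
  case (set A)
  then show ?case by (simp add: em sets)
next
  case (mult u c)
  have "u \<in> borel_measurable (D n)" for n
    using mult measurable_cong_sets[OF sets refl] by blast
  with mult show ?case
    by (simp add: nn_integral_cmult mult.left_commute)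
next
  case (add u v)
  have "u \<in> borel_measurable (D n)" "v \<in> borel_measurable (D n)" for n
    using add measurable_cong_sets[OF sets refl] by blast+
  with add show ?case
    by (simp add: nn_integral_add distrib_left suminf_add[OF summableI summableI])
next
  case (seq U)
  have U: "U i \<in> borel_measurable (D n)" for i n
    using seq measurable_cong_sets[OF sets refl] by blast
  have "(\<integral>\<^sup>+ x. (SUP i. U i x) \<partial>M) = (SUP i. \<Sum>n. w n * (\<integral>\<^sup>+ x. U i x \<partial>D n))"
    using seq by (simp add: nn_integral_monotone_convergence_SUP)
  also have "\<dots> = (\<Sum>n. SUP i. w n * (\<integral>\<^sup>+ x. U i x \<partial>D n))"
  proof (rule ennreal_suminf_SUP_eq[symmetric])
    show "incseq (\<lambda>i. w n * (\<integral>\<^sup>+ x. U i x \<partial>D n))" for n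
      using \<open>incseq U\<close> by (auto simp: incseq_def le_fun_def intro!: mult_left_mono nn_integral_mono)
  qed
  also have "\<dots> = (\<Sum>n. w n * (\<integral>\<^sup>+ x. (SUP i. U i x) \<partial>D n))"
    using \<open>incseq U\<close> U by (simp add: nn_integral_monotone_convergence_SUP SUP_mult_left_ennreal)
  finally show ?case by (simp add: SUP_apply[abs_def])
qed

text \<open>Each point is counted at the index of its first occurrence. This turns the cardinality
  of a possibly non-injective image into a finite sum of indicators, whose measurability can be read
  off.\<close>

lemma card_image_Int:
  fixes n :: nat
  shows "card (g ` {..<n} \<inter> A) = (\<Sum>i<n. if g i \<in> A \<and> (\<forall>j<i. g j \<noteq> g i) then 1 else 0 :: nat)"
proof (induction n)
  case (Suc n)
  have "g ` {..<Suc n} \<inter> A = (if g n \<in> A then insert (g n) (g ` {..<n} \<inter> A) else g ` {..<n} \<inter> A)"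
    by (auto simp: lessThan_Suc)
  moreover have "g n \<in> g ` {..<n} \<longleftrightarrow> \<not> (\<forall>j<n. g j \<noteq> g n)"
    by (metis imageE imageI lessThan_iff)
  ultimately show ?case using Suc by (simp add: card_insert_if)
qed simp

section \<open>The measurable space of configurations\<close>

definition conf_algebra :: "'a::euclidean_space set \<Rightarrow> 'a set measure" where
  "conf_algebra B = sigma (conf_space B)
     {{x \<in> conf_space B. card (x \<inter> A) = n} | A n. A \<in> sets borel}"

lemma space_conf_algebra [simp]: "space (conf_algebra B) = conf_space B"
  unfolding conf_algebra_def by (rule space_measure_of) auto

lemma sets_conf_algebra: "sets (conf_algebra B) = conf_sets B"
  unfolding conf_algebra_def conf_sets_def by (rule sets_measure_of) auto

lemma conf_sets_subset_Pow: "conf_sets B \<subseteq> Pow (conf_space B)"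
  using sets.space_closed[of "conf_algebra B"] by (simp add: sets_conf_algebra)

text \<open>The sets of a \<open>measure_of\<close> do not depend on whether its set function is
  countably additive, so this is available before the Poisson law is known to be given by its
  series.\<close>

lemma sets_poisson_law [measurable_cong]: "sets (poisson_law lam B) = sets (conf_algebra B)"
  unfolding poisson_law_def using conf_sets_subset_Pow[of B]
  by (simp add: sets_measure_of sets_conf_algebra)
    (metis sets.sigma_sets_eq sets_conf_algebra space_conf_algebra)

lemma space_poisson_law [simp]: "space (poisson_law lam B) = conf_space B"
  using sets_eq_imp_space_eq[OF sets_poisson_law, of lam B] by simp

lemma measurable_conf_algebraI:
  assumes "\<And>\<omega>. \<omega> \<in> space N \<Longrightarrow> X \<omega> \<in> conf_space B"
    and "\<And>A. A \<in> sets borel \<Longrightarrow> (\<lambda>\<omega>. card (X \<omega> \<inter> A)) \<in> measurable N (count_space UNIV)"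
  shows "X \<in> measurable N (conf_algebra B)"
  unfolding conf_algebra_def
proof (rule measurable_measure_of)
  fix y assume "y \<in> {{x \<in> conf_space B. card (x \<inter> A) = n} | A n. A \<in> sets borel}"
  then obtain A n where A: "A \<in> sets borel" and y: "y = {x \<in> conf_space B. card (x \<inter> A) = n}"
    by auto
  have "X -` y \<inter> space N = (\<lambda>\<omega>. card (X \<omega> \<inter> A)) -` {n} \<inter> space N"
    using assms(1) y by auto
  also have "\<dots> \<in> sets N" using assms(2)[OF A] by (rule measurable_sets) simp
  finally show "X -` y \<inter> space N \<in> sets N" .
qed (use assms(1) in auto)

lemma measurable_card_conf:
  assumes "A \<in> sets borel"
  shows "(\<lambda>x. card (x \<inter> A)) \<in> measurable (conf_algebra B) (count_space UNIV)"
proof (rule measurable_count_space_eq2_countable[THEN iffD2], safe)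
  fix n
  have "{x \<in> conf_space B. card (x \<inter> A) = n} \<in> sets (conf_algebra B)"
    unfolding sets_conf_algebra conf_sets_def using assms by (intro sigma_sets.Basic) auto
  moreover have "(\<lambda>x. card (x \<inter> A)) -` {n} \<inter> space (conf_algebra B) = {x \<in> conf_space B. card (x \<inter> A) = n}"
    by auto
  ultimately show "(\<lambda>x. card (x \<inter> A)) -` {n} \<inter> space (conf_algebra B) \<in> sets (conf_algebra B)"
    by simp
qed auto

text \<open>Points common to \<open>x\<close> and \<open>y\<close> must not be counted twice, so
  \<open>x\<close> is counted on \<open>A - y\<close>; this set is again Borel because
  \<open>y\<close> is finite and hence closed.\<close>

lemma measurable_Un_conf:
  assumes y: "y \<in> conf_space B"
  shows "(\<lambda>x. y \<union> x) \<in> measurable (conf_algebra B) (conf_algebra B)"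
proof (rule measurable_conf_algebraI)
  fix A :: "'a set" assume A: "A \<in> sets borel"
  have fin: "finite y" using y by (simp add: conf_space_def)
  have eq: "card ((y \<union> x) \<inter> A) = card (y \<inter> A) + card (x \<inter> (A - y))" if "x \<in> space (conf_algebra B)" for x
  proof -
    have "(y \<union> x) \<inter> A = (y \<inter> A) \<union> (x \<inter> (A - y))" by auto
    moreover have "finite x" using that by (simp add: conf_space_def)
    moreover have "(y \<inter> A) \<inter> (x \<inter> (A - y)) = {}" by auto
    ultimately show ?thesis using fin by (simp add: card_Un_disjoint)
  qed
  have "A - y \<in> sets borel"
    using sets.Diff[OF A borel_closed[OF finite_imp_closed[OF fin]]] .
  then have "(\<lambda>x. card (y \<inter> A) + card (x \<inter> (A - y))) \<in> measurable (conf_algebra B) (count_space UNIV)"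
    by (rule measurable_compose[OF measurable_card_conf]) simp
  then show "(\<lambda>x. card ((y \<union> x) \<inter> A)) \<in> measurable (conf_algebra B) (count_space UNIV)"
    by (subst measurable_cong[OF eq])
qed (use y in \<open>auto simp: conf_space_def\<close>)

locale poisson_setting =
  fixes B :: "'a::euclidean_space set" and lam :: "'a measure"
  assumes B_borel: "B \<in> sets borel"
    and sets_lam: "sets lam = sets (restrict_space borel B)"
    and finite_lam: "finite_measure lam"
    and atomless: "\<And>x. x \<in> B \<Longrightarrow> emeasure lam {x} = 0"
begin

sublocale lam: finite_measure lam by (rule finite_lam)

sublocale product_sigma_finite "\<lambda>_::nat. lam" by unfold_locales

lemma space_lam [simp]: "space lam = B"
  using sets_eq_imp_space_eq[OF sets_lam] by (simp add: space_restrict_space)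

text \<open>The measure \<open>lam\<close> lives on the subspace \<open>B\<close>; composing with
  the inclusion gives access to vector space operations, in particular to differences of
  points.\<close>

lemma measurable_lam_borel [measurable_dest]:
  assumes "g \<in> measurable N lam" shows "g \<in> borel_measurable N"
proof -
  have "(\<lambda>x. x) \<in> borel_measurable lam"
    using measurable_restrict_space1[of "\<lambda>x. x" borel borel B] measurable_cong_sets[OF sets_lam refl]
    by auto
  then show ?thesis using measurable_compose[OF assms] by blast
qed

lemma measurable_image_conf:
  fixes g :: "nat \<Rightarrow> 'b \<Rightarrow> 'a"
  assumes "\<And>i. i < n \<Longrightarrow> g i \<in> measurable N lam"
  shows "(\<lambda>\<omega>. (\<lambda>i. g i \<omega>) ` {..<n}) \<in> measurable N (conf_algebra B)"
proof (rule measurable_conf_algebraI)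
  fix \<omega> assume "\<omega> \<in> space N"
  then show "(\<lambda>i. g i \<omega>) ` {..<n} \<in> conf_space B"
    using measurable_space[OF assms] by (auto simp: conf_space_def)
next
  fix A :: "'a set" assume A: "A \<in> sets borel"
  have g: "g i \<in> borel_measurable N" if "i < n" for i
    using measurable_lam_borel[OF assms[OF that]] .
  have *: "Measurable.pred N (\<lambda>\<omega>. g i \<omega> \<in> A \<and> (\<forall>j<i. g j \<omega> \<noteq> g i \<omega>))" if "i < n" for i
  proof -
    have "Measurable.pred N (\<lambda>\<omega>. g j \<omega> = g i \<omega>)" if "j < i" for j
    proof -
      \<comment> \<open>Coincidence of two points is the event that their Borel measurable
        difference is zero.\<close>
      have "(\<lambda>\<omega>. g j \<omega> - g i \<omega>) \<in> borel_measurable N"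
        using g \<open>i < n\<close> that by (intro borel_measurable_diff) auto
      then have "Measurable.pred N (\<lambda>\<omega>. g j \<omega> - g i \<omega> \<in> {0})"
        by (rule pred_sets2[rotated]) simp
      then show ?thesis by simp
    qed
    moreover have "Measurable.pred N (\<lambda>\<omega>. g i \<omega> \<in> A)"
      using g[OF that] by (rule pred_sets2[OF A])
    ultimately show ?thesis
      by (intro pred_intros_logic pred_intros_countable_bounded) auto
  qed
  have "(\<lambda>\<omega>. \<Sum>i<n. if g i \<omega> \<in> A \<and> (\<forall>j<i. g j \<omega> \<noteq> g i \<omega>) then 1 else 0 :: nat) \<in> measurable N (count_space UNIV)"
    using * by (intro measurable_sum_nat measurable_If measurable_const) (auto simp: pred_def)
  then show "(\<lambda>\<omega>. card ((\<lambda>i. g i \<omega>) ` {..<n} \<inter> A)) \<in> measurable N (count_space UNIV)"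
    by (simp add: card_image_Int)
qed

abbreviation lamn :: "nat \<Rightarrow> (nat \<Rightarrow> 'a) measure" where
  "lamn n \<equiv> PiM {..<n} (\<lambda>_. lam)"

abbreviation "P \<equiv> poisson_law lam B"

text \<open>These weights are not the Poisson probabilities: the missing factor
  \<open>measure lam B ^ n\<close> is the total mass of \<open>lamn n\<close>.\<close>

definition poisson_weight :: "nat \<Rightarrow> ennreal" where
  "poisson_weight n = ennreal (exp (- measure lam B) / fact n)"

lemma space_lamn: "space (lamn n) = PiE {..<n} (\<lambda>_. B)"
  by (simp add: space_PiM)

lemma measurable_image_lamn [measurable]: "(\<lambda>z. z ` {..<n}) \<in> measurable (lamn n) (conf_algebra B)"
  by (rule measurable_image_conf[of n "\<lambda>i z. z i"]) (rule measurable_component_singleton, simp)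

lemma measurable_image_Un [measurable]:
  "(\<lambda>(y, w). y ` {..<r} \<union> w ` {..<n}) \<in> measurable (lamn r \<Otimes>\<^sub>M lamn n) (conf_algebra B)"
proof -
  \<comment> \<open>The union of two images is the image of the concatenated tuple, so measurability
    of images of a single tuple applies.\<close>
  have eq: "y ` {..<r} \<union> w ` {..<n} = (\<lambda>i. if i < r then y i else w (i - r)) ` {..<r + n}"
    for y w :: "nat \<Rightarrow> 'a"
  proof -
    define h where "h = (\<lambda>i. if i < r then y i else w (i - r))"
    have split: "{..<r + n} = {..<r} \<union> (\<lambda>i. i + r) ` {..<n}"
    proof (intro set_eqI iffI)
      fix i assume i: "i \<in> {..<r + n}"
      show "i \<in> {..<r} \<union> (\<lambda>i. i + r) ` {..<n}"
        using i image_eqI[of i "\<lambda>i. i + r" "i - r" "{..<n}"] by (cases "i < r") auto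
    qed auto
    have "h ` {..<r} = y ` {..<r}" "h ` (\<lambda>i. i + r) ` {..<n} = w ` {..<n}"
      unfolding image_image by (intro image_cong; simp add: h_def)+
    then have "h ` {..<r + n} = y ` {..<r} \<union> w ` {..<n}"
      by (simp only: split image_Un)
    then show ?thesis by (simp only: h_def)
  qed
  have "(\<lambda>\<omega>. (\<lambda>i. if i < r then fst \<omega> i else snd \<omega> (i - r)) ` {..<r + n})
      \<in> measurable (lamn r \<Otimes>\<^sub>M lamn n) (conf_algebra B)"
  proof (rule measurable_image_conf)
    fix i assume i: "i < r + n"
    show "(\<lambda>\<omega>. if i < r then fst \<omega> i else snd \<omega> (i - r)) \<in> lamn r \<Otimes>\<^sub>M lamn n \<rightarrow>\<^sub>M lam"
    proof (cases "i < r")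
      case True
      then show ?thesis
        using measurable_compose[OF measurable_fst measurable_component_singleton[of i "{..<r}" "\<lambda>_. lam"]] by simp
    next
      case False
      then show ?thesis
        using i measurable_compose[OF measurable_snd measurable_component_singleton[of "i - r" "{..<n}" "\<lambda>_. lam"]] by simp
    qed
  qed
  then show ?thesis by (simp add: eq split_beta')
qed

section \<open>Integration against the Poisson law\<close>

lemma emeasure_poisson_law:
  assumes S: "S \<in> sets (conf_algebra B)"
  shows "emeasure P S
    = (\<Sum>n. poisson_weight n * emeasure (distr (lamn n) (conf_algebra B) (\<lambda>z. z ` {..<n})) S)"
proof -
  let ?D = "\<lambda>n. distr (lamn n) (conf_algebra B) (\<lambda>z. z ` {..<n})"
  let ?mu = "\<lambda>S. ennreal (exp (- measure lam B)) *
        (\<Sum>n. emeasure (lamn n) ((\<lambda>z. z ` {..<n}) -` S \<inter> space (lamn n)) / ennreal (fact n))"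
  have w: "ennreal (exp (- measure lam B)) * (a / ennreal (fact n)) = poisson_weight n * a" for a n
    unfolding poisson_weight_def
    by (simp add: divide_ennreal_def ennreal_mult' divide_inverse inverse_ennreal mult_ac)
  have mu: "?mu A = (\<Sum>n. poisson_weight n * emeasure (?D n) A)" if "A \<in> sets (conf_algebra B)" for A
    using that by (subst ennreal_suminf_cmult[symmetric]) (simp add: w emeasure_distr)
  have "emeasure P S = ?mu S"
  \<comment> \<open>The defining formula is the value of the measure only once it is known to be
    countably additive. As a weighted series of image measures it is, by exchanging two nonnegative
    series.\<close>
  proof (rule emeasure_measure_of[OF poisson_law_def])
    show "positive (sets P) ?mu"
      by (simp add: positive_def)
    show "countably_additive (sets P) ?mu"
    proof (rule countably_additiveI)
      fix A :: "nat \<Rightarrow> 'a set set"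
      assume A: "range A \<subseteq> sets P" "disjoint_family A" "\<Union> (range A) \<in> sets P"
      then have A': "range A \<subseteq> sets (conf_algebra B)" "\<Union> (range A) \<in> sets (conf_algebra B)"
        by (simp_all add: sets_poisson_law)
      have "(\<Sum>i. ?mu (A i)) = (\<Sum>i. \<Sum>n. poisson_weight n * emeasure (?D n) (A i))"
        using A' by (intro suminf_cong mu) auto
      also have "\<dots> = (\<Sum>n. poisson_weight n * emeasure (?D n) (\<Union> (range A)))"
        using A A' by (subst suminf_swap_ennreal) (simp add: suminf_emeasure)
      finally show "(\<Sum>i. ?mu (A i)) = ?mu (\<Union> (range A))"
        by (simp add: mu[OF A'(2)])
    qed
  qed (use S conf_sets_subset_Pow in \<open>auto simp: sets_poisson_law\<close>)
  then show ?thesis by (simp add: mu[OF S])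
qed

lemma nn_integral_poisson_law:
  assumes g: "g \<in> borel_measurable (conf_algebra B)"
  shows "(\<integral>\<^sup>+ x. g x \<partial>P) = (\<Sum>n. poisson_weight n * (\<integral>\<^sup>+ z. g (z ` {..<n}) \<partial>lamn n))"
proof -
  let ?D = "\<lambda>n. distr (lamn n) (conf_algebra B) (\<lambda>z. z ` {..<n})"
  have "(\<integral>\<^sup>+ x. g x \<partial>P) = (\<Sum>n. poisson_weight n * (\<integral>\<^sup>+ x. g x \<partial>?D n))"
  proof (rule nn_integral_weighted_sum_measure)
    show "g \<in> borel_measurable P"
      using g by (subst measurable_cong_sets[OF sets_poisson_law refl])
  qed (simp_all add: sets_poisson_law emeasure_poisson_law)
  with g show ?thesis by (simp add: nn_integral_distr)
qed

section \<open>Null diagonals and relabelling of coordinates\<close>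

lemma AE_lamn_neq:
  assumes "i < n" "j < n" "i \<noteq> j"
  shows "AE z in lamn n. z i \<noteq> z j"
proof -
  let ?I = "{..<n} - {j}"
  have ins: "insert j ?I = {..<n}" using assms by auto
  have m: "Measurable.pred (lamn n) (\<lambda>z. z i = z j)"
  proof -
    have "(\<lambda>z. z i - z j) \<in> borel_measurable (lamn n)"
      using assms by (intro borel_measurable_diff measurable_lam_borel measurable_component_singleton) auto
    then have "Measurable.pred (lamn n) (\<lambda>z. z i - z j \<in> {0})"
      by (rule pred_sets2[rotated]) simp
    then show ?thesis by simp
  qed
  let ?A = "{z \<in> space (lamn n). z i = z j}"
  have A: "?A \<in> sets (lamn n)" using m by (simp add: pred_def)
  have "emeasure (lamn n) ?A = (\<integral>\<^sup>+ z. indicator ?A z \<partial>lamn n)" using A by simp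
  \<comment> \<open>Integrating out coordinate \<open>j\<close> first leaves, for fixed other
    coordinates, at most the \<open>lam\<close>-mass of the single point \<open>x i\<close>.\<close>
  also have "\<dots> = (\<integral>\<^sup>+ x. (\<integral>\<^sup>+ y. indicator ?A (x(j := y)) \<partial>lam) \<partial>PiM ?I (\<lambda>_. lam))"
    using product_nn_integral_insert[of ?I j "indicator ?A"] A ins by simp
  also have "\<dots> = (\<integral>\<^sup>+ x. 0 \<partial>PiM ?I (\<lambda>_. lam))"
  proof (rule nn_integral_cong)
    fix x assume "x \<in> space (PiM ?I (\<lambda>_. lam))"
    then have xi: "x i \<in> B" using assms by (auto simp: space_PiM PiE_iff)
    have sing: "{x i} \<in> sets lam"
      using xi by (simp add: sets_lam sets_restrict_space image_iff) (metis Int_insert_right_if1 Int_empty_right borel_singleton sets.empty_sets)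
    have "(\<integral>\<^sup>+ y. indicator ?A (x(j := y)) \<partial>lam) \<le> (\<integral>\<^sup>+ y. indicator {x i} y \<partial>lam)"
      using assms by (intro nn_integral_mono) (auto simp: indicator_def)
    also have "\<dots> = 0" using sing atomless[OF xi] by simp
    finally show "(\<integral>\<^sup>+ y. indicator ?A (x(j := y)) \<partial>lam) = 0" by simp
  qed
  finally have "emeasure (lamn n) ?A = 0" by simp
  with A show ?thesis by (subst AE_iff_measurable[of ?A]) auto
qed

lemma AE_lamn_inj: "AE z in lamn n. inj_on z {..<n}"
proof -
  have "AE z in lamn n. \<forall>i\<in>{..<n}. \<forall>j\<in>{..<n}. i \<noteq> j \<longrightarrow> z i \<noteq> z j"
    using AE_lamn_neq[of _ n] by (intro AE_finite_allI AE_impI) auto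
  then show ?thesis by eventually_elim (auto simp: inj_on_def)
qed

text \<open>A product measure is determined by its values on rectangles, and relabelling pulls a
  rectangle back to the rectangle with relabelled factors.\<close>

lemma distr_PiM_bij:
  fixes t :: "nat \<Rightarrow> nat"
  assumes t: "bij_betw t I J" and fin: "finite I"
  shows "distr (PiM J (\<lambda>_. lam)) (PiM I (\<lambda>_. lam)) (\<lambda>z. \<lambda>i\<in>I. z (t i)) = PiM I (\<lambda>_. lam)"
proof (rule PiM_eqI)
  have finJ: "finite J" using t fin bij_betw_finite by blast
  have tJ: "t i \<in> J" if "i \<in> I" for i using t that by (auto simp: bij_betw_def)
  have mt: "(\<lambda>z. \<lambda>i\<in>I. z (t i)) \<in> measurable (PiM J (\<lambda>_. lam)) (PiM I (\<lambda>_. lam))"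
    using tJ by (intro measurable_restrict measurable_component_singleton)
  fix A assume A: "\<And>i. i \<in> I \<Longrightarrow> A i \<in> sets lam"
  let ?s = "inv_into I t"
  have s: "?s j \<in> I" "t (?s j) = j" if "j \<in> J" for j
    using t that by (auto simp: bij_betw_def inv_into_into f_inv_into_f)
  have s': "?s (t i) = i" if "i \<in> I" for i
    using t that by (auto simp: bij_betw_def)
  have "(\<lambda>z. \<lambda>i\<in>I. z (t i)) -` Pi\<^sub>E I A \<inter> space (PiM J (\<lambda>_. lam)) = Pi\<^sub>E J (\<lambda>j. A (?s j))"
  proof (intro set_eqI iffI)
    fix z assume "z \<in> (\<lambda>z. \<lambda>i\<in>I. z (t i)) -` Pi\<^sub>E I A \<inter> space (PiM J (\<lambda>_. lam))"
    then have z: "\<And>i. i \<in> I \<Longrightarrow> z (t i) \<in> A i" "z \<in> extensional J"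
      by (auto simp: space_PiM PiE_iff)
    show "z \<in> Pi\<^sub>E J (\<lambda>j. A (?s j))"
      using z(1)[OF s(1)] z(2) s(2) by (simp add: PiE_iff)
  next
    fix z assume z: "z \<in> Pi\<^sub>E J (\<lambda>j. A (?s j))"
    then have "z (t i) \<in> A i" if "i \<in> I" for i
      using tJ[OF that] s'[OF that] by (metis PiE_mem)
    moreover have "z j \<in> B" if "j \<in> J" for j
      using z that sets.sets_into_space[OF A[OF s(1)[OF that]]] by (auto simp: PiE_iff)
    ultimately show "z \<in> (\<lambda>z. \<lambda>i\<in>I. z (t i)) -` Pi\<^sub>E I A \<inter> space (PiM J (\<lambda>_. lam))"
      using z by (auto simp: space_PiM PiE_iff)
  qed
  moreover have "emeasure (PiM J (\<lambda>_. lam)) (Pi\<^sub>E J (\<lambda>j. A (?s j))) = (\<Prod>j\<in>J. emeasure lam (A (?s j)))"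
    using A s by (intro emeasure_PiM finJ) auto
  moreover have "(\<Prod>j\<in>J. emeasure lam (A (?s j))) = (\<Prod>i\<in>I. emeasure lam (A i))"
    using s' by (subst prod.reindex_bij_betw[OF t, symmetric]) simp
  moreover have "Pi\<^sub>E I A \<in> sets (PiM I (\<lambda>_. lam))"
    using A fin by (intro sets_PiM_I_finite) auto
  ultimately show "emeasure (distr (PiM J (\<lambda>_. lam)) (PiM I (\<lambda>_. lam)) (\<lambda>z. \<lambda>i\<in>I. z (t i))) (Pi\<^sub>E I A)
      = (\<Prod>i\<in>I. emeasure lam (A i))"
    using mt by (simp add: emeasure_distr)
qed (use fin in auto)

lemma nn_integral_PiM_bij:
  fixes t :: "nat \<Rightarrow> nat"
  assumes t: "bij_betw t I J" and fin: "finite I"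
    and h: "h \<in> borel_measurable (PiM I (\<lambda>_. lam))"
  shows "(\<integral>\<^sup>+ z. h (\<lambda>i\<in>I. z (t i)) \<partial>PiM J (\<lambda>_. lam)) = (\<integral>\<^sup>+ y. h y \<partial>PiM I (\<lambda>_. lam))"
proof -
  have "(\<lambda>z. \<lambda>i\<in>I. z (t i)) \<in> measurable (PiM J (\<lambda>_. lam)) (PiM I (\<lambda>_. lam))"
    using t by (intro measurable_restrict measurable_component_singleton) (auto simp: bij_betw_def)
  then show ?thesis
    using h by (subst distr_PiM_bij[OF t fin, symmetric]) (simp add: nn_integral_distr)
qed

subsection \<open>The Mecke formula\<close>

lemma sigma_finite_lamn: "sigma_finite_measure (lamn n)"
proof -
  interpret finite_product_sigma_finite "\<lambda>_. lam" "{..<n}" by unfold_locales simp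
  show ?thesis by (rule sigma_finite_measure_axioms)
qed

lemma measurable_nn_integral_Un:
  assumes q: "q \<in> borel_measurable (conf_algebra B)"
  shows "(\<lambda>y. \<integral>\<^sup>+ w. q (y ` {..<r} \<union> w ` {..<n}) \<partial>lamn n) \<in> borel_measurable (lamn r)"
proof -
  have "(\<lambda>yw. q (case yw of (y, w) \<Rightarrow> y ` {..<r} \<union> w ` {..<n})) \<in> borel_measurable (lamn r \<Otimes>\<^sub>M lamn n)"
    by (rule measurable_compose[OF measurable_image_Un q])
  then show ?thesis
    using sigma_finite_measure.borel_measurable_nn_integral[OF sigma_finite_lamn, of "\<lambda>y w. q (y ` {..<r} \<union> w ` {..<n})"]
    by (simp add: split_beta')
qed

lemma image_in_conf_space: "y \<in> space (lamn r) \<Longrightarrow> y ` {..<r} \<in> conf_space B"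
  by (auto simp: space_lamn conf_space_def PiE_iff)

text \<open>Fubini separates the coordinates selected by \<open>\<iota>\<close> from the remaining
  \<open>n - r\<close>, and both groups are then renumbered from 0. The right side no longer depends
  on \<open>\<iota>\<close>, which is why the sum over index maps becomes a count.\<close>

lemma nn_integral_lamn_split:
  assumes \<iota>: "\<iota> \<in> injs r {..<n}"
    and g: "g \<in> borel_measurable (lamn r)" and q: "q \<in> borel_measurable (conf_algebra B)"
  shows "(\<integral>\<^sup>+ z. g (restrict (z \<circ> \<iota>) {..<r}) * q (z ` {..<n}) \<partial>lamn n)
    = (\<integral>\<^sup>+ y. g y * (\<integral>\<^sup>+ w. q (y ` {..<r} \<union> w ` {..<n - r}) \<partial>lamn (n - r)) \<partial>lamn r)"
proof -
  define I where "I = \<iota> ` {..<r}"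
  define J where "J = {..<n} - I"
  have \<iota>_bij: "bij_betw \<iota> {..<r} I" and I_sub: "I \<subseteq> {..<n}"
    using \<iota> by (auto simp: I_def injs_def bij_betw_def PiE_iff)
  have IJ: "I \<inter> J = {}" "I \<union> J = {..<n}" and fin: "finite I" "finite J"
    using I_sub by (auto simp: J_def intro: finite_subset)
  have "card J = n - r"
    using I_sub bij_betw_same_card[OF \<iota>_bij] by (simp add: J_def card_Diff_subset finite_subset[OF I_sub])
  \<comment> \<open>Any numbering of the remaining coordinates will do, since \<open>q\<close> sees
    only the set of points.\<close>
  then obtain \<kappa> where \<kappa>_bij: "bij_betw \<kappa> {..<n - r} J"
    using ex_bij_betw_nat_finite[OF fin(2)] by (auto simp: atLeast0LessThan)
  have \<iota>_lt: "\<iota> i < n" if "i < r" for i using \<iota> that by (auto simp: injs_def PiE_iff)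
  let ?\<Phi> = "\<lambda>z. g (restrict (z \<circ> \<iota>) {..<r}) * q (z ` {..<n})"
  let ?h = "\<lambda>y w. g y * q (y ` {..<r} \<union> w ` {..<n - r})"
  have "(\<lambda>z. restrict (z \<circ> \<iota>) {..<r}) \<in> measurable (lamn n) (lamn r)"
    using \<iota>_lt unfolding comp_def by (intro measurable_restrict measurable_component_singleton) simp
  then have \<Phi>: "?\<Phi> \<in> borel_measurable (lamn n)"
    using measurable_compose[OF _ g] measurable_compose[OF measurable_image_lamn q] by (intro borel_measurable_times_ennreal) auto
  have h: "?h y \<in> borel_measurable (lamn (n - r))" if "y \<in> space (lamn r)" for y
    using measurable_compose[OF measurable_image_lamn measurable_compose[OF measurable_Un_conf q]]
      image_in_conf_space[OF that] by (intro borel_measurable_times_ennreal) auto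
  have H: "(\<lambda>y. \<integral>\<^sup>+ w. ?h y w \<partial>lamn (n - r)) \<in> borel_measurable (lamn r)"
  proof -
    have "(\<lambda>yw. q (case yw of (y, w) \<Rightarrow> y ` {..<r} \<union> w ` {..<n - r})) \<in> borel_measurable (lamn r \<Otimes>\<^sub>M lamn (n - r))"
      by (rule measurable_compose[OF measurable_image_Un q])
    moreover have "(\<lambda>yw. g (fst yw)) \<in> borel_measurable (lamn r \<Otimes>\<^sub>M lamn (n - r))"
      by (rule measurable_compose[OF measurable_fst g])
    ultimately have "(\<lambda>yw. g (fst yw) * q (case yw of (y, w) \<Rightarrow> y ` {..<r} \<union> w ` {..<n - r}))
        \<in> borel_measurable (lamn r \<Otimes>\<^sub>M lamn (n - r))"
      by (rule borel_measurable_times_ennreal[rotated])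
    then show ?thesis
      using sigma_finite_measure.borel_measurable_nn_integral[OF sigma_finite_lamn, of ?h]
      by (simp add: split_beta')
  qed
  have "(\<integral>\<^sup>+ z. ?\<Phi> z \<partial>lamn n)
      = (\<integral>\<^sup>+ x. (\<integral>\<^sup>+ w. ?\<Phi> (merge I J (x, w)) \<partial>PiM J (\<lambda>_. lam)) \<partial>PiM I (\<lambda>_. lam))"
    using product_nn_integral_fold[OF IJ(1) fin, of ?\<Phi>] \<Phi> by (simp add: IJ(2))
  also have "\<dots> = (\<integral>\<^sup>+ x. (\<integral>\<^sup>+ w. ?h (\<lambda>i\<in>{..<r}. x (\<iota> i)) w \<partial>lamn (n - r)) \<partial>PiM I (\<lambda>_. lam))"
  proof (rule nn_integral_cong)
    fix x assume x: "x \<in> space (PiM I (\<lambda>_. lam))"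
    let ?y = "\<lambda>i\<in>{..<r}. x (\<iota> i)"
    have y: "?y \<in> space (lamn r)"
      using x by (auto simp: space_PiM PiE_iff I_def)
    have "?\<Phi> (merge I J (x, w)) = ?h ?y (\<lambda>i\<in>{..<n - r}. w (\<kappa> i))" for w
    proof -
      have "restrict (merge I J (x, w) \<circ> \<iota>) {..<r} = ?y"
        by (rule ext) (simp add: merge_def I_def)
      moreover have "merge I J (x, w) ` {..<n} = x ` I \<union> w ` J"
        using IJ(1) by (simp add: image_Un flip: IJ(2))
      moreover have "x ` I = ?y ` {..<r}"
        by (simp add: I_def image_image)
      moreover have "w ` J = (\<lambda>i\<in>{..<n - r}. w (\<kappa> i)) ` {..<n - r}"
        using \<kappa>_bij by (auto simp: bij_betw_def)
      ultimately show ?thesis by simp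
    qed
    then show "(\<integral>\<^sup>+ w. ?\<Phi> (merge I J (x, w)) \<partial>PiM J (\<lambda>_. lam)) = (\<integral>\<^sup>+ w. ?h ?y w \<partial>lamn (n - r))"
      using nn_integral_PiM_bij[OF \<kappa>_bij _ h[OF y]] by simp
  qed
  also have "\<dots> = (\<integral>\<^sup>+ y. (\<integral>\<^sup>+ w. ?h y w \<partial>lamn (n - r)) \<partial>lamn r)"
    using nn_integral_PiM_bij[OF \<iota>_bij _ H] by simp
  also have "\<dots> = (\<integral>\<^sup>+ y. g y * (\<integral>\<^sup>+ w. q (y ` {..<r} \<union> w ` {..<n - r}) \<partial>lamn (n - r)) \<partial>lamn r)"
    using measurable_compose[OF measurable_image_lamn measurable_compose[OF measurable_Un_conf[OF image_in_conf_space] q]]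
    by (intro nn_integral_cong nn_integral_cmult)
  finally show ?thesis .
qed

lemma nn_integral_P_Un:
  assumes q: "q \<in> borel_measurable (conf_algebra B)" and y: "y \<in> space (lamn r)"
  shows "(\<integral>\<^sup>+ x. q (y ` {..<r} \<union> x) \<partial>P)
    = (\<Sum>n. poisson_weight n * (\<integral>\<^sup>+ w. q (y ` {..<r} \<union> w ` {..<n}) \<partial>lamn n))"
  using measurable_compose[OF measurable_Un_conf[OF image_in_conf_space[OF y]] q]
  by (rule nn_integral_poisson_law)

text \<open>Going through the series replaces joint measurability in a tuple and a configuration by
  joint measurability in two tuples.\<close>

lemma measurable_nn_integral_P_Un:
  assumes q: "q \<in> borel_measurable (conf_algebra B)"
  shows "(\<lambda>y. \<integral>\<^sup>+ x. q (y ` {..<r} \<union> x) \<partial>P) \<in> borel_measurable (lamn r)"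
proof -
  have "(\<lambda>y. \<Sum>n. poisson_weight n * (\<integral>\<^sup>+ w. q (y ` {..<r} \<union> w ` {..<n}) \<partial>lamn n)) \<in> borel_measurable (lamn r)"
    using measurable_nn_integral_Un[OF q] by (intro borel_measurable_suminf_order borel_measurable_times_ennreal) auto
  then show ?thesis
    by (subst measurable_cong[OF nn_integral_P_Un[OF q]])
qed

text \<open>Fewer than r points admit no injective selection of r, so the series starts at index r.
  The term of index \<open>n + r\<close> contains (n + r)! / n! equal integrals, which changes its
  weight into \<open>poisson_weight n\<close>; what remains is the series for the inner
  expectation.\<close>

lemma mecke_on_tuples:
  assumes g: "g \<in> borel_measurable (lamn r)" and q: "q \<in> borel_measurable (conf_algebra B)"
  shows "(\<Sum>n. poisson_weight n *
      (\<Sum>\<iota>\<in>injs r {..<n}. \<integral>\<^sup>+ z. g (restrict (z \<circ> \<iota>) {..<r}) * q (z ` {..<n}) \<partial>lamn n))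
    = (\<integral>\<^sup>+ y. g y * (\<integral>\<^sup>+ x. q (y ` {..<r} \<union> x) \<partial>P) \<partial>lamn r)" (is "(\<Sum>n. ?f n) = _")
proof -
  let ?K = "\<lambda>n. \<integral>\<^sup>+ y. g y * (\<integral>\<^sup>+ w. q (y ` {..<r} \<union> w ` {..<n}) \<partial>lamn n) \<partial>lamn r"
  have "(\<Sum>n. ?f n) = (\<Sum>n. ?f (n + r))"
    by (rule suminf_ennreal_shift) (simp add: injs_empty)
  also have "\<dots> = (\<Sum>n. poisson_weight n * ?K n)"
  proof (rule suminf_cong)
    fix n
    have "card (injs r {..<n + r}) * fact n = (fact (n + r) :: nat)"
      using card_injs[of "{..<n + r}" r] by simp
    then have "real (card (injs r {..<n + r})) * fact n = fact (n + r)"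
      by (metis of_nat_fact of_nat_mult)
    then have "exp (- measure lam B) / fact (n + r) * real (card (injs r {..<n + r})) = exp (- measure lam B) / fact n"
      by (simp add: field_simps)
    then have w: "poisson_weight (n + r) * of_nat (card (injs r {..<n + r})) = poisson_weight n"
      by (simp add: poisson_weight_def ennreal_of_nat_eq_real_of_nat flip: ennreal_mult)
    have "?f (n + r) = poisson_weight (n + r) * (\<Sum>\<iota>\<in>injs r {..<n + r}. ?K n)"
      using nn_integral_lamn_split[OF _ g q, of _ "n + r"] by (intro arg_cong2[of _ _ _ _ "(*)"] sum.cong) auto
    also have "\<dots> = poisson_weight n * ?K n"
      by (simp add: w flip: mult.assoc)
    finally show "?f (n + r) = poisson_weight n * ?K n" .
  qed
  also have "\<dots> = (\<Sum>n. \<integral>\<^sup>+ y. g y * (poisson_weight n * (\<integral>\<^sup>+ w. q (y ` {..<r} \<union> w ` {..<n}) \<partial>lamn n)) \<partial>lamn r)"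
    using g measurable_nn_integral_Un[OF q]
    by (subst nn_integral_cmult[symmetric]) (auto simp: mult.left_commute)
  also have "\<dots> = (\<integral>\<^sup>+ y. (\<Sum>n. g y * (poisson_weight n * (\<integral>\<^sup>+ w. q (y ` {..<r} \<union> w ` {..<n}) \<partial>lamn n))) \<partial>lamn r)"
    using g measurable_nn_integral_Un[OF q] by (intro nn_integral_suminf[symmetric]) auto
  also have "\<dots> = (\<integral>\<^sup>+ y. g y * (\<integral>\<^sup>+ x. q (y ` {..<r} \<union> x) \<partial>P) \<partial>lamn r)"
    by (intro nn_integral_cong) (simp add: nn_integral_P_Un[OF q])
  finally show ?thesis .
qed

text \<open>The index set \<open>A\<close> with coefficients \<open>c\<close> serves both
  expansions: partitions with coefficient 1, and overlap numbers with the binomial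
  constants.\<close>

lemma mecke_combination:
  fixes F :: "'a set \<Rightarrow> ennreal" and c :: "'i \<Rightarrow> ennreal"
  assumes A: "finite A"
    and g: "\<And>a. a \<in> A \<Longrightarrow> g a \<in> borel_measurable (lamn (r a))"
    and F: "\<And>x. x \<in> conf_space B \<Longrightarrow> F x = (\<Sum>a\<in>A. c a * (\<Sum>y\<in>injs (r a) x. g a y))"
    and Fq: "(\<lambda>x. F x * q x) \<in> borel_measurable (conf_algebra B)"
    and q: "q \<in> borel_measurable (conf_algebra B)"
  shows "(\<integral>\<^sup>+ x. F x * q x \<partial>P)
    = (\<Sum>a\<in>A. c a * (\<integral>\<^sup>+ y. g a y * (\<integral>\<^sup>+ x. q (y ` {..<r a} \<union> x) \<partial>P) \<partial>lamn (r a)))"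
proof -
  let ?t = "\<lambda>n a \<iota> z. g a (restrict (z \<circ> \<iota>) {..<r a}) * q (z ` {..<n})"
  have t: "?t n a \<iota> \<in> borel_measurable (lamn n)" if "a \<in> A" "\<iota> \<in> injs (r a) {..<n}" for n a \<iota>
  proof (intro borel_measurable_times_ennreal)
    have "(\<lambda>z. restrict (z \<circ> \<iota>) {..<r a}) \<in> measurable (lamn n) (lamn (r a))"
      using that unfolding comp_def
      by (intro measurable_restrict measurable_component_singleton) (auto simp: injs_def PiE_iff)
    then show "(\<lambda>z. g a (restrict (z \<circ> \<iota>) {..<r a})) \<in> borel_measurable (lamn n)"
      using measurable_compose[OF _ g[OF that(1)]] by blast
    show "(\<lambda>z. q (z ` {..<n})) \<in> borel_measurable (lamn n)"
      using measurable_compose[OF measurable_image_lamn q] .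
  qed
  have "(\<integral>\<^sup>+ z. F (z ` {..<n}) * q (z ` {..<n}) \<partial>lamn n)
      = (\<Sum>a\<in>A. c a * (\<Sum>\<iota>\<in>injs (r a) {..<n}. \<integral>\<^sup>+ z. ?t n a \<iota> z \<partial>lamn n))" for n
  proof -
    have "(\<integral>\<^sup>+ z. F (z ` {..<n}) * q (z ` {..<n}) \<partial>lamn n)
        = (\<integral>\<^sup>+ z. (\<Sum>a\<in>A. c a * (\<Sum>\<iota>\<in>injs (r a) {..<n}. ?t n a \<iota> z)) \<partial>lamn n)"
    \<comment> \<open>Only for injective \<open>z\<close> do index maps enumerate each tuple of the
      configuration exactly once; the exceptional set is null.\<close>
    proof (rule nn_integral_cong_AE, use AE_lamn_inj[of n] AE_space in eventually_elim)
      fix z assume inj: "inj_on z {..<n}" and z: "z \<in> space (lamn n)"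
      have "(\<Sum>y\<in>injs (r a) (z ` {..<n}). g a y) = (\<Sum>\<iota>\<in>injs (r a) {..<n}. g a (restrict (z \<circ> \<iota>) {..<r a}))" for a
        by (rule sum.reindex_bij_betw[OF bij_betw_injs_image[OF inj], symmetric])
      then show "F (z ` {..<n}) * q (z ` {..<n}) = (\<Sum>a\<in>A. c a * (\<Sum>\<iota>\<in>injs (r a) {..<n}. ?t n a \<iota> z))"
        by (simp add: F[OF image_in_conf_space[OF z]] sum_distrib_right mult.assoc)
    qed
    also have "\<dots> = (\<Sum>a\<in>A. c a * (\<Sum>\<iota>\<in>injs (r a) {..<n}. \<integral>\<^sup>+ z. ?t n a \<iota> z \<partial>lamn n))"
      using t by (simp add: nn_integral_sum nn_integral_cmult)
    finally show ?thesis .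
  qed
  then have "(\<integral>\<^sup>+ x. F x * q x \<partial>P)
      = (\<Sum>n. \<Sum>a\<in>A. c a * (poisson_weight n * (\<Sum>\<iota>\<in>injs (r a) {..<n}. \<integral>\<^sup>+ z. ?t n a \<iota> z \<partial>lamn n)))"
    by (simp add: nn_integral_poisson_law[OF Fq] sum_distrib_left mult.left_commute)
  also have "\<dots> = (\<Sum>a\<in>A. c a * (\<Sum>n. poisson_weight n * (\<Sum>\<iota>\<in>injs (r a) {..<n}. \<integral>\<^sup>+ z. ?t n a \<iota> z \<partial>lamn n)))"
    by (subst suminf_sum) (simp_all add: summableI)
  also have "\<dots> = (\<Sum>a\<in>A. c a * (\<integral>\<^sup>+ y. g a y * (\<integral>\<^sup>+ x. q (y ` {..<r a} \<union> x) \<partial>P) \<partial>lamn (r a)))"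
    using mecke_on_tuples[OF g q] by (intro sum.cong) auto
  finally show ?thesis .
qed

end

section \<open>Densities and conditional intensities\<close>

lemma (in poisson_setting) measurable_lambda_star:
  assumes p: "p \<in> borel_measurable P" and y: "y \<in> space (lamn r)"
  shows "lambda_star p r y \<in> borel_measurable P"
proof -
  have "(\<lambda>x. p (y ` {..<r} \<union> x)) \<in> borel_measurable P"
    using measurable_compose[OF measurable_Un_conf[OF image_in_conf_space[OF y]]] p
    by (simp add: measurable_cong_sets[OF sets_poisson_law refl])
  then have [measurable]: "(\<lambda>x. p (x \<union> y ` {..<r})) \<in> borel_measurable P"
    by (simp add: Un_commute)
  note p [measurable]
  show ?thesis unfolding lambda_star_def by measurable
qed

locale hereditary_density = poisson_setting B lam
  for B :: "'a::euclidean_space set" and lam :: "'a measure" +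
  fixes p :: "'a set \<Rightarrow> real"
  assumes p_meas: "p \<in> borel_measurable (poisson_law lam B)"
    and p_nonneg: "\<And>x. x \<in> conf_space B \<Longrightarrow> 0 \<le> p x"
    and p_hered: "\<And>x y. x \<in> conf_space B \<Longrightarrow> y \<subseteq> x \<Longrightarrow> p x > 0 \<Longrightarrow> p y > 0"
begin

abbreviation "Q \<equiv> density P (\<lambda>x. ennreal (p x))"

lemma p_meas_conf: "(\<lambda>x. ennreal (p x)) \<in> borel_measurable (conf_algebra B)"
  using p_meas by (simp add: measurable_cong_sets[OF sets_poisson_law refl])

lemma AE_p_nonneg: "AE x in P. 0 \<le> p x"
  by (rule AE_I2) (simp add: p_nonneg)

text \<open>The critical case is \<open>p x = 0\<close>, where the conditional intensity cannot be a
  quotient: by heredity no larger configuration has positive density, so both sides vanish.\<close>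

lemma p_mult_lambda_star:
  assumes x: "x \<in> conf_space B" and y: "y \<in> space (lamn r)"
  shows "p x * lambda_star p r y x = p (y ` {..<r} \<union> x)"
proof -
  have xy: "x \<union> y ` {..<r} \<in> conf_space B"
    using x image_in_conf_space[OF y] by (auto simp: conf_space_def)
  show ?thesis
  proof (cases "p x > 0")
    case True
    then show ?thesis by (simp add: lambda_star_def Un_commute)
  next
    case False
    then have "\<not> p (x \<union> y ` {..<r}) > 0"
      using p_hered[OF xy] by blast
    then have "p (x \<union> y ` {..<r}) = 0" "p x = 0"
      using p_nonneg[OF xy] p_nonneg[OF x] False by auto
    then show ?thesis by (simp add: Un_commute)
  qed
qed

text \<open>Where the expectation is infinite both sides are 0, the left by the Bochner convention
  and the right by \<open>enn2real\<close>.\<close>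

lemma expectation_lambda_star:
  assumes y: "y \<in> space (lamn r)"
  shows "(\<integral>x. lambda_star p r y x \<partial>Q) = enn2real (\<integral>\<^sup>+ x. ennreal (p (y ` {..<r} \<union> x)) \<partial>P)"
proof -
  have m: "(\<lambda>x. p (y ` {..<r} \<union> x)) \<in> borel_measurable P"
    using measurable_compose[OF measurable_Un_conf[OF image_in_conf_space[OF y]]] p_meas
    by (simp add: measurable_cong_sets[OF sets_poisson_law refl])
  have "(\<integral>x. lambda_star p r y x \<partial>Q) = (\<integral>x. p x * lambda_star p r y x \<partial>P)"
    using integral_density[OF measurable_lambda_star[OF p_meas y] p_meas AE_p_nonneg] by simp
  also have "\<dots> = (\<integral>x. p (y ` {..<r} \<union> x) \<partial>P)"
    by (intro Bochner_Integration.integral_cong) (simp_all add: p_mult_lambda_star y)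
  also have "\<dots> = enn2real (\<integral>\<^sup>+ x. ennreal (p (y ` {..<r} \<union> x)) \<partial>P)"
    using image_in_conf_space[OF y]
    by (intro integral_eq_nn_integral[OF m] AE_I2 p_nonneg) (auto simp: conf_space_def)
  finally show ?thesis .
qed

text \<open>The extended nonnegative identity of \<open>mecke_combination\<close> with
  \<open>q = p\<close> becomes a real one after each summand is shown finite.\<close>

lemma expectation_combination:
  fixes F :: "'a set \<Rightarrow> real" and c :: "'i \<Rightarrow> real"
  assumes A: "finite A" and c: "\<And>a. a \<in> A \<Longrightarrow> 0 \<le> c a"
    and g: "\<And>a. a \<in> A \<Longrightarrow> g a \<in> borel_measurable (lamn (r a))"
    and g_nonneg: "\<And>a y. a \<in> A \<Longrightarrow> y \<in> space (lamn (r a)) \<Longrightarrow> 0 \<le> g a y"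
    and F: "\<And>x. x \<in> conf_space B \<Longrightarrow> F x = (\<Sum>a\<in>A. c a * (\<Sum>y\<in>injs (r a) x. g a y))"
    and F_meas: "F \<in> borel_measurable P"
    and F_L2: "integrable P (\<lambda>x. (F x)\<^sup>2)" and p_L2: "integrable P (\<lambda>x. (p x)\<^sup>2)"
  shows "(\<integral>x. F x \<partial>Q)
    = (\<Sum>a\<in>A. c a * (\<integral>y. g a y * (\<integral>x. lambda_star p (r a) y x \<partial>Q) \<partial>lamn (r a)))"
proof -
  let ?I = "\<lambda>a y. \<integral>\<^sup>+ x. ennreal (p (y ` {..<r a} \<union> x)) \<partial>P"
  let ?N = "\<lambda>a. \<integral>\<^sup>+ y. ennreal (g a y) * ?I a y \<partial>lamn (r a)"
  have g_injs: "0 \<le> g a y" if "a \<in> A" "x \<in> conf_space B" "y \<in> injs (r a) x" for a x y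
    using that by (intro g_nonneg) (auto simp: injs_def space_lamn conf_space_def PiE_iff)
  have F_nonneg: "0 \<le> F x" if "x \<in> conf_space B" for x
    using c g_injs that by (auto simp: F intro!: sum_nonneg mult_nonneg_nonneg)
  have F_ennreal: "ennreal (F x) = (\<Sum>a\<in>A. ennreal (c a) * (\<Sum>y\<in>injs (r a) x. ennreal (g a y)))"
    if "x \<in> conf_space B" for x
  proof -
    have "ennreal (F x) = (\<Sum>a\<in>A. ennreal (c a * (\<Sum>y\<in>injs (r a) x. g a y)))"
      using c g_injs that by (auto simp: F intro!: sum_ennreal[symmetric] sum_nonneg mult_nonneg_nonneg)
    also have "\<dots> = (\<Sum>a\<in>A. ennreal (c a) * (\<Sum>y\<in>injs (r a) x. ennreal (g a y)))"
      using c g_injs that by (intro sum.cong refl) (simp add: ennreal_mult sum_nonneg sum_ennreal)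
    finally show ?thesis .
  qed
  have pF_int: "integrable P (\<lambda>x. p x * F x)"
  proof (rule Bochner_Integration.integrable_bound[OF Bochner_Integration.integrable_add[OF F_L2 p_L2]])
    show "(\<lambda>x. p x * F x) \<in> borel_measurable P"
      using p_meas F_meas by (rule borel_measurable_times)
    \<comment> \<open>This elementary bound makes \<open>p x * F x\<close> integrable from the two
      square integrability assumptions.\<close>
    have "\<bar>a * b\<bar> \<le> \<bar>b\<^sup>2 + a\<^sup>2\<bar>" for a b :: real
      using sum_squares_bound[of "\<bar>a\<bar>" "\<bar>b\<bar>"] mult_nonneg_nonneg[of "\<bar>a\<bar>" "\<bar>b\<bar>"]
      unfolding abs_mult power2_abs by linarith
    then show "AE x in P. norm (p x * F x) \<le> norm ((F x)\<^sup>2 + (p x)\<^sup>2)"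
      by simp
  qed
  have Fq: "(\<lambda>x. ennreal (F x) * ennreal (p x)) \<in> borel_measurable (conf_algebra B)"
    using F_meas p_meas by (simp add: measurable_cong_sets[OF sets_poisson_law refl])
  have main: "(\<integral>\<^sup>+ x. ennreal (p x * F x) \<partial>P) = (\<Sum>a\<in>A. ennreal (c a) * ?N a)"
  proof -
    have "(\<integral>\<^sup>+ x. ennreal (p x * F x) \<partial>P) = (\<integral>\<^sup>+ x. ennreal (F x) * ennreal (p x) \<partial>P)"
      by (intro nn_integral_cong) (simp add: ennreal_mult F_nonneg p_nonneg mult.commute)
    also have "\<dots> = (\<Sum>a\<in>A. ennreal (c a) * ?N a)"
      using g by (intro mecke_combination A F_ennreal Fq p_meas_conf) auto
    finally show ?thesis .
  qed
  have fin: "ennreal (c a) * ?N a < top" if "a \<in> A" for a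
  proof -
    have "ennreal (c a) * ?N a \<le> (\<Sum>a\<in>A. ennreal (c a) * ?N a)"
      using A that by (intro member_le_sum) auto
    also have "\<dots> < top"
      unfolding main[symmetric] using integrableD(2)[OF pF_int] by (simp add: top.not_eq_extremum)
    finally show ?thesis .
  qed
  have summand: "enn2real (ennreal (c a) * ?N a)
      = c a * (\<integral>y. g a y * (\<integral>x. lambda_star p (r a) y x \<partial>Q) \<partial>lamn (r a))" if a: "a \<in> A" for a
  \<comment> \<open>A zero coefficient is treated apart, since finiteness of the weighted summand
    then says nothing about the integral behind it.\<close>
  proof (cases "c a = 0")
    case False
    with c[OF a] have pos: "ennreal (c a) \<noteq> 0" by simp
    have N_fin: "?N a < top" using fin[OF a] pos by (auto simp: ennreal_mult_less_top)
    have gI: "(\<lambda>y. ennreal (g a y) * ?I a y) \<in> borel_measurable (lamn (r a))"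
      using g[OF a] measurable_nn_integral_P_Un[OF p_meas_conf, of "r a"] by measurable
    have fin_ae: "AE y in lamn (r a). ennreal (g a y) * ?I a y \<noteq> \<infinity>"
      using nn_integral_noteq_infinite[OF gI] N_fin by simp
    \<comment> \<open>Finiteness of the outer integral gives a finite inner one almost everywhere
      that \<open>g a\<close> is positive; where \<open>g a\<close> is 0 the inner one may be
      infinite, but both sides are 0.\<close>
    have ae: "AE y in lamn (r a). ennreal (g a y * enn2real (?I a y)) = ennreal (g a y) * ?I a y"
    proof (use fin_ae AE_space in eventually_elim)
      fix y assume "y \<in> space (lamn (r a))" and ne: "ennreal (g a y) * ?I a y \<noteq> \<infinity>"
      then have "0 \<le> g a y" using g_nonneg a by blast
      with ne show "ennreal (g a y * enn2real (?I a y)) = ennreal (g a y) * ?I a y"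
        by (cases "g a y = 0") (auto simp: ennreal_mult ennreal_mult_eq_top_iff less_top)
    qed
    have "(\<integral>y. g a y * (\<integral>x. lambda_star p (r a) y x \<partial>Q) \<partial>lamn (r a))
        = (\<integral>y. g a y * enn2real (?I a y) \<partial>lamn (r a))"
      by (intro Bochner_Integration.integral_cong) (simp_all add: expectation_lambda_star)
    also have "\<dots> = enn2real (\<integral>\<^sup>+ y. ennreal (g a y * enn2real (?I a y)) \<partial>lamn (r a))"
    proof (rule integral_eq_nn_integral)
      show "(\<lambda>y. g a y * enn2real (?I a y)) \<in> borel_measurable (lamn (r a))"
        using g[OF a] measurable_nn_integral_P_Un[OF p_meas_conf, of "r a"] by measurable
      show "AE y in lamn (r a). 0 \<le> g a y * enn2real (?I a y)"
        using g_nonneg[OF a] by (intro AE_I2) simp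
    qed
    also have "\<dots> = enn2real (?N a)"
      using nn_integral_cong_AE[OF ae] by simp
    finally show ?thesis using c[OF a] by (simp add: enn2real_mult)
  qed simp
  have "(\<integral>x. F x \<partial>Q) = (\<integral>x. p x * F x \<partial>P)"
    using integral_density[OF F_meas p_meas AE_p_nonneg] by simp
  also have "\<dots> = enn2real (\<integral>\<^sup>+ x. ennreal (p x * F x) \<partial>P)"
    using F_nonneg p_nonneg
    by (intro integral_eq_nn_integral borel_measurable_integrable[OF pF_int] AE_I2) simp
  also have "\<dots> = (\<Sum>a\<in>A. enn2real (ennreal (c a) * ?N a))"
    unfolding main using fin by (simp add: enn2real_sum)
  finally show ?thesis using summand by simp
qed

end

section \<open>Measurability of the kernels and the two moment formulas\<close>

lemma (in poisson_setting) measurable_reindex_lamn: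
  assumes "\<And>l. l < k \<Longrightarrow> s l < n"
  shows "(\<lambda>y. restrict (\<lambda>l. y (s l)) {..<k}) \<in> measurable (lamn n) (lamn k)"
  using assms by (intro measurable_restrict measurable_component_singleton) simp

lemma bidx_less_card:
  assumes "\<sigma> \<in> Pi_part m k" "i < m" "l < k i"
  shows "bidx \<sigma> (offs k i + l) < card \<sigma>"
proof -
  have "offs k i + l \<in> Jblock k i" using assms(3) by (simp add: Jblock_def)
  then have "offs k i + l \<in> {..<offs k m}" using Jblock_subset[OF assms(2)] by blast
  then show ?thesis
    using bidx_image[of "offs k m" \<sigma>] assms(1) by (auto simp: Pi_part_def)
qed

theorem theorem3:
  fixes B :: "'a::euclidean_space set" and lam :: "'a measure"
    and p :: "'a set \<Rightarrow> real"
    and m :: nat and k :: "nat \<Rightarrow> nat" and f :: "nat \<Rightarrow> (nat \<Rightarrow> 'a) \<Rightarrow> real"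
  assumes B: "B \<in> sets borel" "bounded B" "emeasure lborel B > 0"
    and lam: "sets lam = sets (restrict_space borel B)" "finite_measure lam"
             "\<forall>x\<in>B. emeasure lam {x} = 0"
    and p_meas: "p \<in> borel_measurable (poisson_law lam B)"
    and p_nonneg: "\<forall>x\<in>conf_space B. 0 \<le> p x"
    and p_int: "(\<integral>\<^sup>+ x. ennreal (p x) \<partial>poisson_law lam B) = 1"
    and p_hered: "\<forall>x\<in>conf_space B. \<forall>y. y \<subseteq> x \<longrightarrow> p x > 0 \<longrightarrow> p y > 0"
    and p_L2: "integrable (poisson_law lam B) (\<lambda>x. (p x)\<^sup>2)"
    and f_int: "\<forall>i<m. integrable (PiM {..<k i} (\<lambda>_. lam)) (f i)"
    and f_nonneg: "\<forall>i<m. \<forall>z\<in>space (PiM {..<k i} (\<lambda>_. lam)). 0 \<le> f i z"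
    and f_sym: "\<forall>i<m. \<forall>\<pi>. \<pi> permutes {..<k i} \<longrightarrow>
                  (\<forall>z\<in>PiE {..<k i} (\<lambda>_. B). f i (z \<circ> \<pi>) = f i z)"
    and F_meas: "(\<lambda>x. \<Prod>i<m. ustat (k i) (f i) x) \<in> borel_measurable (poisson_law lam B)"
    and F_L2: "integrable (poisson_law lam B) (\<lambda>x. (\<Prod>i<m. ustat (k i) (f i) x)\<^sup>2)"
  shows
    "(\<integral>x. (\<Prod>i<m. ustat (k i) (f i) x) \<partial>(density (poisson_law lam B) (\<lambda>x. ennreal (p x))))
       = (\<Sum>\<sigma>\<in>Pi_part m k.
            \<integral>y. tensor_sigma m k f \<sigma> y *
                 (\<integral>x. lambda_star p (card \<sigma>) y x \<partial>(density (poisson_law lam B) (\<lambda>x. ennreal (p x))))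
              \<partial>(PiM {..<card \<sigma>} (\<lambda>_. lam)))
     \<and> (m = 2 \<and> k 1 \<le> k 0 \<longrightarrow>
        (\<integral>x. ustat (k 0) (f 0) x * ustat (k 1) (f 1) x
              \<partial>(density (poisson_law lam B) (\<lambda>x. ennreal (p x))))
        = (\<Sum>j\<le>k 1. real (k 1 choose j) * fact (k 0) / fact (k 0 - k 1 + j) *
             (\<integral>y. h_fun (k 0) (k 1) j (f 0) (f 1) y *
                 (\<integral>x. lambda_star p (k 0 + j) y x
                     \<partial>(density (poisson_law lam B) (\<lambda>x. ennreal (p x))))
               \<partial>(PiM {..<k 0 + j} (\<lambda>_. lam)))))"
proof -
  interpret hereditary_density B lam p
  proof (intro hereditary_density.intro poisson_setting.intro hereditary_density_axioms.intro)
    show "p y > 0" if "x \<in> conf_space B" "y \<subseteq> x" "p x > 0" for x y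
      using p_hered that by blast
  qed (use B lam p_meas p_nonneg in simp_all)
  have f_meas: "f i \<in> borel_measurable (lamn (k i))" if "i < m" for i
    using f_int that by blast
  have tensor_arg: "(\<lambda>y. restrict (\<lambda>l. y (bidx \<sigma> (offs k i + l))) {..<k i}) \<in> measurable (lamn (card \<sigma>)) (lamn (k i))"
    if "\<sigma> \<in> Pi_part m k" "i < m" for \<sigma> i
    using bidx_less_card[OF that] by (rule measurable_reindex_lamn)
  \<comment> \<open>The factor 1 is the coefficient expected by
    \<open>expectation_combination\<close>.\<close>
  have part1: "(\<integral>x. (\<Prod>i<m. ustat (k i) (f i) x) \<partial>Q)
      = (\<Sum>\<sigma>\<in>Pi_part m k. 1 * (\<integral>y. tensor_sigma m k f \<sigma> y *
          (\<integral>x. lambda_star p (card \<sigma>) y x \<partial>Q) \<partial>lamn (card \<sigma>)))"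
  proof (rule expectation_combination[OF finite_Pi_part _ _ _ _ F_meas F_L2 p_L2])
    fix \<sigma> assume \<sigma>: "\<sigma> \<in> Pi_part m k"
    show "tensor_sigma m k f \<sigma> \<in> borel_measurable (lamn (card \<sigma>))"
      unfolding tensor_sigma_def
      using measurable_compose[OF tensor_arg[OF \<sigma>] f_meas] by (intro borel_measurable_prod) auto
    show "0 \<le> tensor_sigma m k f \<sigma> y" if "y \<in> space (lamn (card \<sigma>))" for y
      unfolding tensor_sigma_def
      using f_nonneg measurable_space[OF tensor_arg[OF \<sigma>] that] by (intro prod_nonneg) auto
  next
    fix x assume "x \<in> conf_space B"
    then show "(\<Prod>i<m. ustat (k i) (f i) x)
        = (\<Sum>\<sigma>\<in>Pi_part m k. 1 * (\<Sum>y\<in>injs (card \<sigma>) x. tensor_sigma m k f \<sigma> y))"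
      using prod_ustat_eq_sum_partitions[of x] by (simp add: conf_space_def)
  qed simp
  have part2: "(\<integral>x. ustat (k 0) (f 0) x * ustat (k 1) (f 1) x \<partial>Q)
      = (\<Sum>j\<le>k 1. real (k 1 choose j) * fact (k 0) / fact (k 0 - k 1 + j) *
          (\<integral>y. h_fun (k 0) (k 1) j (f 0) (f 1) y *
            (\<integral>x. lambda_star p (k 0 + j) y x \<partial>Q) \<partial>lamn (k 0 + j)))"
    if m: "m = 2" and le: "k 1 \<le> k 0"
  proof (rule expectation_combination)
    have prod2: "(\<Prod>i<m. ustat (k i) (f i) x) = ustat (k 0) (f 0) x * ustat (k 1) (f 1) x" for x
      by (simp add: m numeral_2_eq_2)
    show "(\<lambda>x. ustat (k 0) (f 0) x * ustat (k 1) (f 1) x) \<in> borel_measurable P"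
      using F_meas by (simp only: prod2)
    show "integrable P (\<lambda>x. (ustat (k 0) (f 0) x * ustat (k 1) (f 1) x)\<^sup>2)"
      using F_L2 by (simp only: prod2)
    show "integrable P (\<lambda>x. (p x)\<^sup>2)" by (rule p_L2)
    fix x assume "x \<in> conf_space B"
    then have x: "finite x" "x \<subseteq> B" by (auto simp: conf_space_def)
    show "ustat (k 0) (f 0) x * ustat (k 1) (f 1) x
        = (\<Sum>j\<le>k 1. real (k 1 choose j) * fact (k 0) / fact (k 0 - k 1 + j) *
            (\<Sum>y\<in>injs (k 0 + j) x. h_fun (k 0) (k 1) j (f 0) (f 1) y))"
      using f_sym m by (intro ustat_mult_ustat[OF x le]) auto
  next
    fix j assume "j \<in> {..k 1}"
    then have j: "j \<le> k 1" by simp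
    have a2: "(\<lambda>y. restrict (\<lambda>l. y l) {..<k 1}) \<in> measurable (lamn (k 0 + j)) (lamn (k 1))"
      using le by (intro measurable_reindex_lamn) auto
    \<comment> \<open>With the case distinction moved into the index of \<open>y\<close>, the
      argument of the first kernel is a mere selection of coordinates.\<close>
    have "(\<lambda>y. restrict (\<lambda>l. y (if l < k 1 - j then l else l + j)) {..<k 0})
        \<in> measurable (lamn (k 0 + j)) (lamn (k 0))"
      by (rule measurable_reindex_lamn) auto
    then have a1: "(\<lambda>y. restrict (\<lambda>l. if l < k 1 - j then y l else y (l + j)) {..<k 0})
        \<in> measurable (lamn (k 0 + j)) (lamn (k 0))"
      by (simp add: if_distrib)
    show "h_fun (k 0) (k 1) j (f 0) (f 1) \<in> borel_measurable (lamn (k 0 + j))"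
      unfolding h_fun_def
      using measurable_compose[OF a1 f_meas] measurable_compose[OF a2 f_meas] m
      by (intro borel_measurable_times) auto
    show "0 \<le> h_fun (k 0) (k 1) j (f 0) (f 1) y" if "y \<in> space (lamn (k 0 + j))" for y
      unfolding h_fun_def
      using f_nonneg m measurable_space[OF a1 that] measurable_space[OF a2 that]
      by (intro mult_nonneg_nonneg) auto
  qed auto
  show ?thesis
    using part1 part2 by simp
qed

end
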